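(* Let $n\ge 1$ and $k\ge 2$ be integers. The algorithm GenCharm described below, run with alphabet $\{0,1,\ldots,k-1\}$ and length $n$, outputs exactly the $k$-ary charm bracelets of length $n$, each exactly once, and it runs in $O(n^3)$ amortized time per charm bracelet output, i.e. its total running time is $O(n^3\cdot |\mathbf{CB}_k(n)|)$, where $\mathbf{CB}_k(n)$ is the set of $k$-ary charm bracelets of length $n$.
   Context: Strings $\alpha=a_0a_1\cdots a_{n-1}$ over $\{0,\ldots,k-1\}$ are indexed by $\mathbb{Z}_n=\mathbb{Z}/n\mathbb{Z}$. The group of affine maps $j\mapsto a+dj \pmod n$ with $a,d\in\mathbb{Z}_n$ and $\gcd(d,n)=1$ acts on strings by acting on the indices. A charm bracelet is the lexicographically smallest string in an orbit (equivalence class) of this action. A necklace is the lexicographically smallest string in an orbit of the rotation group alone ($d=1$). Let $\Phi(n)$ be the set of positive integers less than $n$ that are relatively prime to $n$, and for $d\in\Phi(n)$ let $\mathrm{inv}(d,\alpha)$ be the string obtained from $\alpha$ by moving the symbol at index $j$ to index $dj \bmod n$. Let $\mathrm{neck}(\beta)$ be the necklace representative (least rotation) of $\beta$. Algorithm GenCharm: (1) Generate all $k$-ary necklaces of length $n$ with the standard recursive Fredricksen–Kessler–Maiorana scheme: with $a_0=0$, the call GenCharm$(t,p)$, for $t\le n$, loops $i$ from $a_{t-p}$ to $k-1$, sets $a_t=i$, and calls GenCharm$(t+1,p)$ if $i=a_{t-p}$ and GenCharm$(t+1,t)$ otherwise; when $t>n$, the string $\alpha=a_1\cdots a_n$ is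 a necklace exactly when $n \bmod p=0$; initial call GenCharm$(1,1)$. (2) For each necklace $\alpha$ so produced, for every $d\in\Phi(n)$ compute $\mathrm{neck}(\mathrm{inv}(d,\alpha))$ (in linear time, by a least-rotation computation on the doubled string $\beta\beta$); if some such necklace is lexicographically smaller than $\alpha$, reject $\alpha$; otherwise output $\alpha$. *)

theory Defs
  imports Complex_Main "HOL-Library.List_Lexorder" "HOL-Library.State_Monad"
begin

section \<open>Strings and charm bracelets\<close>

text \<open>
  Strings are lists; \<open>\<le>\<close> and \<open><\<close> on lists are the lexicographic orders of
  \<^theory>\<open>HOL-Library.List_Lexorder\<close>.
\<close>

definition strings :: "nat \<Rightarrow> nat \<Rightarrow> nat list set" where
  "strings k n = {\<alpha>. length \<alpha> = n \<and> set \<alpha> \<subseteq> {..<k}}"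

text \<open>
  The affine map \<open>j \<mapsto> a + d j\<close> moves the symbol at index \<open>j\<close> to index \<open>a + d j mod n\<close>.
  Residues modulo \<open>n\<close> are represented by \<open>0, \<dots>, n - 1\<close>; for \<open>n = 1\<close> the only admissible
  multiplier is \<open>d = 0\<close>.
\<close>

definition affine_orbit :: "nat list \<Rightarrow> nat list set" where
  "affine_orbit \<alpha> = (let n = length \<alpha> in
     {\<beta>. length \<beta> = n \<and>
        (\<exists>a<n. \<exists>d<n. coprime d n \<and> (\<forall>j<n. \<beta> ! ((a + d * j) mod n) = \<alpha> ! j))})"

definition charm_bracelets :: "nat \<Rightarrow> nat \<Rightarrow> nat list set" where
  "charm_bracelets k n = {\<alpha> \<in> strings k n. \<forall>\<beta> \<in> affine_orbit \<alpha>. \<alpha> \<le> \<beta>}"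


section \<open>A unit-cost random access machine\<close>

text \<open>
  Programs are shallowly embedded in the state monad. The memory consists of three arrays of
  natural numbers, and \<open>clock\<close> counts executed instructions. The following each cost one unit:
  an arithmetic operation (\<open>calc\<close>, applied to a single operation only), a comparison with a
  conditional jump (\<open>branch\<close>), an array access (\<open>rd\<close>, \<open>wr\<close>), and the output of one symbol.
  Every cycle in the control flow, be it a loop or a recursive call, passes through at least
  one of these.
\<close>

datatype array =
    Alpha  \<comment> \<open>the string under construction, cells \<open>1, \<dots>, n\<close>, with sentinel cell \<open>0\<close>\<close>
  | Beta   \<comment> \<open>a doubled string, cells \<open>0, \<dots>, 2 n - 1\<close>\<close>
  | Units  \<comment> \<open>the elements of \<open>\<Phi> n\<close>\<close>

record machine =
  mem :: "array \<Rightarrow> nat \<Rightarrow> nat"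
  outputs :: "nat list list"
  clock :: nat

type_synonym 'a prog = "(machine, 'a) state"

definition tick :: "unit prog" where
  "tick = State (\<lambda>s. ((), s\<lparr>clock := clock s + 1\<rparr>))"

definition rd :: "array \<Rightarrow> nat \<Rightarrow> nat prog" where
  "rd A i = State (\<lambda>s. (mem s A i, s\<lparr>clock := clock s + 1\<rparr>))"

definition wr :: "array \<Rightarrow> nat \<Rightarrow> nat \<Rightarrow> unit prog" where
  "wr A i v = State (\<lambda>s. ((), s\<lparr>mem := (mem s)(A := (mem s A)(i := v)), clock := clock s + 1\<rparr>))"

definition emit :: "nat \<Rightarrow> unit prog" where
  "emit n = State (\<lambda>s. ((), s\<lparr>outputs := outputs s @ [map (mem s Alpha) [1..<n + 1]],
                               clock := clock s + n\<rparr>))"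

abbreviation ret :: "'a \<Rightarrow> 'a prog" where
  "ret \<equiv> State_Monad.return"

definition calc :: "nat \<Rightarrow> nat prog" where
  "calc x = do { tick; ret x }"

abbreviation branch :: "bool \<Rightarrow> 'a prog \<Rightarrow> 'a prog \<Rightarrow> 'a prog" where
  "branch b P Q \<equiv> State_Monad.bind tick (\<lambda>_. if b then P else Q)"

lemma fst_run_calc [simp]: "fst (run_state (calc x) s) = x"
  by (simp add: calc_def tick_def)

lemma bind_prog_cong [fundef_cong]:
  assumes "m = m'" "\<And>x s. x = fst (run_state m' s) \<Longrightarrow> f x = g x"
  shows "State_Monad.bind m f = State_Monad.bind m' g"
proof (rule state_ext)
  fix s
  have "f (fst (run_state m' s)) = g (fst (run_state m' s))"
    using assms(2) by blast
  then show "run_state (State_Monad.bind m f) s = run_state (State_Monad.bind m' g) s"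
    by (simp add: assms(1) split_beta)
qed

text \<open>\<open>for_loop i hi body x\<close> runs \<open>body\<close> for \<open>i, \<dots>, hi - 1\<close>, threading an accumulator \<open>x\<close>.\<close>

function for_loop :: "nat \<Rightarrow> nat \<Rightarrow> (nat \<Rightarrow> 'a \<Rightarrow> 'a prog) \<Rightarrow> 'a \<Rightarrow> 'a prog" where
  "for_loop i hi body x =
     branch (i < hi)
       (do { y \<leftarrow> body i x; i' \<leftarrow> calc (i + 1); for_loop i' hi body y })
       (ret x)"
  by pat_completeness auto
termination by (relation "measure (\<lambda>(i, hi, _, _). hi - i)") auto

declare for_loop.simps [simp del]


section \<open>The algorithm\<close>

function euclid :: "nat \<Rightarrow> nat \<Rightarrow> nat prog" where
  "euclid a b =
     branch (b = 0) (ret a) (do { r \<leftarrow> calc (a mod b); euclid b r })"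
  by pat_completeness auto
termination by (relation "measure snd") auto

declare euclid.simps [simp del]

text \<open>Stores the positive integers less than and coprime to \<open>n\<close> in \<^const>\<open>Units\<close> and returns their number.\<close>

definition find_units :: "nat \<Rightarrow> nat prog" where
  "find_units n =
     for_loop 1 n (\<lambda>d u. do {
       g \<leftarrow> euclid d n;
       branch (g = 1) (do { wr Units u d; calc (u + 1) }) (ret u) }) 0"

text \<open>Stores \<open>\<beta> \<beta>\<close> in \<^const>\<open>Beta\<close>, where \<open>\<beta> = inv(d, \<alpha>)\<close>; the symbol of \<open>\<alpha>\<close> with index \<open>j\<close> is in cell \<open>j + 1\<close>.\<close>

definition store_inv :: "nat \<Rightarrow> nat \<Rightarrow> unit prog" where
  "store_inv n d =
     for_loop 0 n (\<lambda>j _. do {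
       c \<leftarrow> calc (j + 1);
       x \<leftarrow> rd Alpha c;
       m \<leftarrow> calc (d * j);
       i \<leftarrow> calc (m mod n);
       wr Beta i x;
       i' \<leftarrow> calc (i + n);
       wr Beta i' x }) ()"

text \<open>
  Least rotation of the doubled string in \<^const>\<open>Beta\<close>, by the classical two-candidate method:
  \<open>i\<close> and \<open>j\<close> are competing starting positions whose rotations agree on the first \<open>l\<close> symbols.
  On a mismatch at offset \<open>l\<close>, none of the \<open>l + 1\<close> consecutive positions starting at the losing
  candidate starts a least rotation. With initial arguments \<open>0 1 0\<close> the result is a starting
  position \<open>r\<close> of a least rotation, which is \<open>Beta[r], \<dots>, Beta[r + n - 1]\<close>.
\<close>

function least_rotation :: "nat \<Rightarrow> nat \<Rightarrow> nat \<Rightarrow> nat \<Rightarrow> nat prog" where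
  "least_rotation n i j l =
     (let finish = branch (i < j) (ret i) (ret j) in
      branch (i < n) (branch (j < n) (branch (l < n)
        (do {
           u \<leftarrow> calc (i + l);
           x \<leftarrow> rd Beta u;
           v \<leftarrow> calc (j + l);
           y \<leftarrow> rd Beta v;
           branch (x = y)
             (do { l' \<leftarrow> calc (l + 1); least_rotation n i j l' })
             (branch (x > y)
               (do { i' \<leftarrow> calc (u + 1);
                     branch (i' = j)
                       (do { i'' \<leftarrow> calc (i' + 1); least_rotation n i'' j 0 })
                       (least_rotation n i' j 0) })
               (do { j' \<leftarrow> calc (v + 1);
                     branch (j' = i)
                       (do { j'' \<leftarrow> calc (j' + 1); least_rotation n i j'' 0 })
                       (least_rotation n i j' 0) })) })
        finish) finish) finish)"
  by pat_completeness auto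
termination by (relation "measure (\<lambda>(n, i, j, l). 3 * n - (i + j + l))") auto

declare least_rotation.simps [simp del]

text \<open>Whether \<open>Beta[r + m], \<dots>, Beta[r + n - 1]\<close> is lexicographically smaller than \<open>Alpha[m + 1], \<dots>, Alpha[n]\<close>.\<close>

function lex_smaller :: "nat \<Rightarrow> nat \<Rightarrow> nat \<Rightarrow> bool prog" where
  "lex_smaller n r m =
     branch (m < n)
       (do {
          i \<leftarrow> calc (r + m);
          x \<leftarrow> rd Beta i;
          m' \<leftarrow> calc (m + 1);
          y \<leftarrow> rd Alpha m';
          branch (x < y) (ret True) (branch (y < x) (ret False) (lex_smaller n r m')) })
       (ret False)"
  by pat_completeness auto
termination by (relation "measure (\<lambda>(n, r, m). n - m)") auto

declare lex_smaller.simps [simp del]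

text \<open>The test of a necklace \<open>\<alpha>\<close>; \<open>u\<close> is the number of elements of \<open>\<Phi> n\<close>.\<close>

definition process_necklace :: "nat \<Rightarrow> nat \<Rightarrow> unit prog" where
  "process_necklace n u = do {
     ok \<leftarrow> for_loop 0 u (\<lambda>q ok. do {
       d \<leftarrow> rd Units q;
       store_inv n d;
       r \<leftarrow> least_rotation n 0 1 0;
       s \<leftarrow> lex_smaller n r 0;
       branch s (ret False) (ret ok) }) True;
     branch ok (emit n) (ret ()) }"

function gen_charm :: "nat \<Rightarrow> nat \<Rightarrow> nat \<Rightarrow> nat \<Rightarrow> nat \<Rightarrow> unit prog" where
  "gen_charm n k u t p =
     branch (t > n)
       (do { r \<leftarrow> calc (n mod p);
             branch (r = 0) (process_necklace n u) (ret ()) })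
       (do { c \<leftarrow> calc (t - p);
             x \<leftarrow> rd Alpha c;
             for_loop x k (\<lambda>i _. do {
               wr Alpha t i;
               t' \<leftarrow> calc (t + 1);
               branch (i = x) (gen_charm n k u t' p) (gen_charm n k u t' t) }) () })"
  by pat_completeness auto
termination by (relation "measure (\<lambda>(n, k, u, t, p). n + 1 - t)") auto

declare gen_charm.simps [simp del]

definition charm_program :: "nat \<Rightarrow> nat \<Rightarrow> unit prog" where
  "charm_program n k = do {
     u \<leftarrow> find_units n;
     wr Alpha 0 0;
     gen_charm n k u 1 1 }"

definition initial_machine :: machine where
  "initial_machine = \<lparr>mem = (\<lambda>_ _. 0), outputs = [], clock = 0\<rparr>"

definition charm_output :: "nat \<Rightarrow> nat \<Rightarrow> nat list list" where
  "charm_output n k = outputs (snd (run_state (charm_program n k) initial_machine))"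

definition charm_time :: "nat \<Rightarrow> nat \<Rightarrow> nat" where
  "charm_time n k = clock (snd (run_state (charm_program n k) initial_machine))"

end

theory Submission
  imports Defs "HOL-Number_Theory.Cong"
begin

text \<open>
  The recursion visits exactly the prenecklaces, each together with the length \<open>p\<close> of its longest
  Lyndon prefix, which is also a period; a prenecklace of length \<open>n\<close> is a necklace iff \<open>p\<close>
  divides \<open>n\<close>. A charm bracelet is a necklace that is not beaten by any rotation of any
  \<open>inv(d, \<alpha>)\<close>, so filtering the necklaces is correct.

  For the running time, a visited prenecklace of length \<open>t\<close> is determined by \<open>t\<close>, \<open>p\<close> and its
  prefix of length \<open>p\<close>; padding this Lyndon prefix with the largest symbol gives a necklace. So at
  most \<open>n\<^sup>2 N\<close> nonempty prenecklaces are visited, where \<open>N\<close> is the number of necklaces, and the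
  tests cost \<open>O(n\<^sup>2)\<close> per necklace. Finally, up to rotation an affine orbit consists of the at most
  \<open>n\<close> strings \<open>inv(d, \<alpha>)\<close>, so \<open>N\<close> is at most \<open>n\<close> times the number of charm bracelets.
\<close>


section \<open>Least rotations\<close>

lemma list_less_iff_nth:
  fixes xs ys :: "'a::linorder list"
  assumes "length xs = length ys"
  shows "xs < ys \<longleftrightarrow> (\<exists>l < length xs. (\<forall>j<l. xs ! j = ys ! j) \<and> xs ! l < ys ! l)"
  using assms by (auto simp: list_less_def lexord_take_index_conv nth_take_lemma list_eq_iff_nth_eq)

lemma list_le_iff_nth:
  fixes xs ys :: "'a::linorder list"
  assumes "length xs = length ys"
  shows "xs \<le> ys \<longleftrightarrow> (\<forall>l < length xs. (\<forall>j<l. xs ! j = ys ! j) \<longrightarrow> xs ! l \<le> ys ! l)"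
  using assms by (auto simp: list_less_iff_nth linorder_not_less[symmetric] eq_commute)

lemma exists_least_rotation:
  fixes xs :: "'a::linorder list"
  assumes "xs \<noteq> []"
  obtains r where "r < length xs" "\<And>r'. rotate r xs \<le> rotate r' xs"
proof -
  let ?S = "(\<lambda>r. rotate r xs) ` {..<length xs}"
  have "Min ?S \<in> ?S" using assms by (intro Min_in) auto
  then obtain r where r: "r < length xs" "rotate r xs = Min ?S" by auto
  have "rotate r xs \<le> rotate r' xs" for r'
  proof -
    have "rotate r' xs = rotate (r' mod length xs) xs" by (rule rotate_conv_mod)
    also have "\<dots> \<in> ?S" using assms by auto
    finally show ?thesis using r by simp
  qed
  then show ?thesis using that r by blast
qed

text \<open>Cutting the first \<open>k\<close> symbols off both rotations keeps their first
  mismatch, now at offset \<open>l - k\<close>. So one mismatch rules out \<open>l + 1\<close>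
  starting positions.\<close>

lemma rotate_less_after_mismatch:
  fixes xs :: "'a::linorder list"
  assumes "l < length xs" "k \<le> l"
    and "\<And>h. h < l \<Longrightarrow> xs ! ((i + h) mod length xs) = xs ! ((j + h) mod length xs)"
    and "xs ! ((j + l) mod length xs) < xs ! ((i + l) mod length xs)"
  shows "rotate (j + k) xs < rotate (i + k) xs"
proof -
  have "rotate (j + k) xs ! h = rotate (i + k) xs ! h" if "h < l - k" for h
    using that assms(1,2) assms(3)[of "k + h"] by (simp add: nth_rotate add_ac)
  moreover have "rotate (j + k) xs ! (l - k) < rotate (i + k) xs ! (l - k)"
    using assms(1,2,4) by (simp add: nth_rotate)
  ultimately show ?thesis
    using assms(1) by (auto simp: list_less_iff_nth intro!: exI[of _ "l - k"])
qed

text \<open>Equal rotations make the string invariant under a shift by \<open>j - i\<close>. A least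
  start at or beyond \<open>j\<close> can therefore be lowered by \<open>j - i\<close> until it
  falls below \<open>j\<close>, where only \<open>i\<close> survives. This settles the case in which
  both candidates agree on all symbols.\<close>

lemma least_rotation_of_periodic:
  fixes xs :: "'a::linorder list"
  assumes "xs \<noteq> []" "i < j" "rotate i xs = rotate j xs"
    and excl: "\<And>r. r < j \<Longrightarrow> r \<noteq> i \<Longrightarrow> \<exists>r'. rotate r' xs < rotate r xs"
  shows "rotate i xs \<le> rotate r' xs"
proof -
  obtain r where "\<And>r'. rotate r xs \<le> rotate r' xs"
    using exists_least_rotation assms(1) by metis
  then have "\<forall>r'. rotate i xs \<le> rotate r' xs"
  proof (induction r rule: less_induct)
    case (less r)
    show ?case
    proof (cases "r < j")
      case True
      then show ?thesis using excl[of r] less.prems by (cases "r = i") (auto simp: not_less[symmetric])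
    next
      case False
      then have "rotate r xs = rotate (r - j) (rotate j xs)" by (simp add: rotate_rotate)
      also have "\<dots> = rotate (r - j + i) xs" by (simp add: rotate_rotate assms(3)[symmetric])
      finally show ?thesis using less.IH[of "r - j + i"] less.prems False assms(2) by auto
    qed
  qed
  then show ?thesis ..
qed

section \<open>Multiplication by a unit modulo n\<close>

lemma mult_mod_inj:
  fixes d n :: nat
  assumes "coprime d n" "j < n" "j' < n" "d * j mod n = d * j' mod n"
  shows "j = j'"
proof -
  have "[d * j = d * j'] (mod n)" using assms(4) by (simp add: cong_def)
  then have "[j = j'] (mod n)" using assms(1) by (simp add: cong_mult_lcancel_nat)
  then show ?thesis using assms(2,3) by (simp add: cong_def)
qed

lemma mult_mod_surj:
  fixes d n :: nat
  assumes "coprime d n" "0 < n"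
  obtains j where "j < n" "d * j mod n = i mod n"
proof -
  obtain x where "[d * x = Suc 0] (mod n)" using assms(1) cong_solve_coprime_nat by blast
  then have "[d * x * i = Suc 0 * i] (mod n)" by (rule cong_scalar_right)
  then have "d * (x * i mod n) mod n = i mod n"
    by (simp add: cong_def mod_mult_right_eq mult.assoc)
  then show ?thesis using that[of "x * i mod n"] assms(2) by simp
qed

section \<open>Weakest preconditions\<close>

text \<open>Programs are total and deterministic, so evaluating the run suffices and no separate
  termination condition arises.\<close>

definition wp :: "'a prog \<Rightarrow> ('a \<Rightarrow> machine \<Rightarrow> bool) \<Rightarrow> machine \<Rightarrow> bool" where
  "wp P Q s = (case run_state P s of (x, s') \<Rightarrow> Q x s')"

lemma wp_bind [simp]: "wp (State_Monad.bind P f) Q = wp P (\<lambda>x. wp (f x) Q)"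
  by (simp add: wp_def split_beta fun_eq_iff)

lemma wp_return [simp]: "wp (ret x) Q s = Q x s"
  by (simp add: wp_def)

lemma wp_tick [simp]: "wp tick Q s = Q () (s\<lparr>clock := clock s + 1\<rparr>)"
  by (simp add: wp_def tick_def)

lemma wp_calc [simp]: "wp (calc x) Q s = Q x (s\<lparr>clock := clock s + 1\<rparr>)"
  by (simp add: calc_def)

lemma wp_rd [simp]: "wp (rd X i) Q s = Q (mem s X i) (s\<lparr>clock := clock s + 1\<rparr>)"
  by (simp add: wp_def rd_def)

lemma wp_wr [simp]:
  "wp (wr X i v) Q s = Q () (s\<lparr>mem := (mem s)(X := (mem s X)(i := v)), clock := clock s + 1\<rparr>)"
  by (simp add: wp_def wr_def)

lemma wp_emit [simp]:
  "wp (emit n) Q s = Q () (s\<lparr>outputs := outputs s @ [map (mem s Alpha) [1..<n + 1]], clock := clock s + n\<rparr>)"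
  by (simp add: wp_def emit_def)

lemma wp_if [simp]: "wp (if b then P else R) Q s = (if b then wp P Q s else wp R Q s)"
  by simp

lemma wp_mono:
  assumes "wp P Q s" "\<And>x s'. Q x s' \<Longrightarrow> R x s'"
  shows "wp P R s"
  using assms by (auto simp: wp_def split_beta)

text \<open>The two clock shifts around \<open>body\<close> are the loop test and the increment of
  the index; the shift in the last premise is the final failing test. An iteration thus costs two
  units besides its body.\<close>

lemma wp_for_loop:
  assumes "i \<le> hi" "I i x s"
    and body: "\<And>j y s. i \<le> j \<Longrightarrow> j < hi \<Longrightarrow> I j y s \<Longrightarrow>
      wp (body j y) (\<lambda>z s'. I (Suc j) z (s'\<lparr>clock := clock s' + 1\<rparr>)) (s\<lparr>clock := clock s + 1\<rparr>)"
    and fin: "\<And>y s. I hi y s \<Longrightarrow> Q y (s\<lparr>clock := clock s + 1\<rparr>)"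
  shows "wp (for_loop i hi body x) Q s"
  using assms(1,2) body
proof (induction "hi - i" arbitrary: i x s)
  case 0
  then show ?case using fin[of x s] by (subst for_loop.simps) simp
next
  case (Suc m)
  have lt: "i < hi" using Suc.hyps(2) by linarith
  have "wp (for_loop (Suc i) hi body z) Q (s'\<lparr>clock := Suc (clock s')\<rparr>)"
    if "I (Suc i) z (s'\<lparr>clock := Suc (clock s')\<rparr>)" for z s'
    using that lt Suc.hyps(2) Suc.prems(3) by (intro Suc.hyps(1)) auto
  then show ?case
    using lt wp_mono[OF Suc.prems(3)[OF order_refl lt Suc.prems(2)]]
    by (subst for_loop.simps) simp
qed

section \<open>Correctness and cost of the subroutines\<close>

lemma wp_euclid:
  "wp (euclid a b) (\<lambda>g s'. g = gcd a b \<and> (\<exists>c \<le> 2 * b + 1. s' = s\<lparr>clock := clock s + c\<rparr>)) s"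
proof (induction b arbitrary: a s rule: less_induct)
  case (less b)
  show ?case
  proof (cases "b = 0")
    case True
    then show ?thesis by (subst euclid.simps) (auto intro!: exI[of _ 1])
  next
    case False
    \<comment> \<open>Each level costs two units and lowers the second argument. The resulting
      linear bound is enough, because the set-up may take quadratic time.\<close>
    then have lt: "a mod b < b" by simp
    show ?thesis
      apply (subst euclid.simps)
      using False apply simp
      apply (rule wp_mono[OF less[OF lt]])
      using lt apply (clarsimp simp: gcd_red_nat[of a b])
      subgoal for c by (rule exI[of _ "c + 2"]) auto
      done
  qed
qed

text \<open>Only the set of stored units is recorded, since the test runs over all of them. An
  iteration costs at most \<open>2 * n + 6\<close>; there are \<open>n - 1\<close> of them, which
  leaves room for the last loop test.\<close>

lemma wp_find_units:
  assumes "1 \<le> n"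
  shows "wp (find_units n) (\<lambda>u s'. u \<le> n \<and> mem s' Units ` {..<u} = {d. 1 \<le> d \<and> d < n \<and> coprime d n} \<and>
     mem s' Alpha = mem s Alpha \<and> outputs s' = outputs s \<and> clock s' \<le> clock s + n * (2 * n + 6)) s"
  unfolding find_units_def
  apply (rule wp_for_loop[where I = "\<lambda>i u s'. u < i \<and> mem s' Units ` {..<u} = {d. 1 \<le> d \<and> d < i \<and> coprime d n} \<and>
     mem s' Alpha = mem s Alpha \<and> outputs s' = outputs s \<and> clock s' \<le> clock s + (i - 1) * (2 * n + 6)"])
  subgoal using assms by simp
  subgoal by auto
  subgoal for j y s'
    apply simp
    apply (rule wp_mono[OF wp_euclid])
    apply (clarsimp simp: coprime_iff_gcd_eq_1)
    apply (intro conjI impI)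
    subgoal premises prems for c
    proof -
      have "((mem s' Units)(y := j)) ` {..<Suc y} = insert j (mem s' Units ` {..<y})"
        by (auto simp: image_iff less_Suc_eq)
      moreover obtain j' where "j = Suc j'" using prems by (cases j) auto
      ultimately show ?thesis using prems by (auto simp: less_Suc_eq coprime_iff_gcd_eq_1)
    qed
    apply (cases j; auto simp: less_Suc_eq coprime_iff_gcd_eq_1)+
    done
  subgoal for y s' using assms by (cases n) auto
  done

text \<open>As \<open>d\<close> is a unit, distinct \<open>j\<close> write to distinct cells, and
  the offset \<open>n\<close> separates the two copies. Hence no write destroys an earlier
  one.\<close>

lemma wp_store_inv:
  assumes "coprime d n" "1 \<le> n"
  shows "wp (store_inv n d) (\<lambda>_ s'. (\<forall>j<n. mem s' Beta (d * j mod n) = mem s Alpha (j + 1) \<and>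
      mem s' Beta (d * j mod n + n) = mem s Alpha (j + 1)) \<and> mem s' Units = mem s Units \<and>
     mem s' Alpha = mem s Alpha \<and> outputs s' = outputs s \<and> clock s' = clock s + 9 * n + 1) s"
  unfolding store_inv_def
  apply (rule wp_for_loop[where I = "\<lambda>i _ s'. (\<forall>j<i. mem s' Beta (d * j mod n) = mem s Alpha (j + 1) \<and>
      mem s' Beta (d * j mod n + n) = mem s Alpha (j + 1)) \<and> mem s' Units = mem s Units \<and>
     mem s' Alpha = mem s Alpha \<and> outputs s' = outputs s \<and> clock s' = clock s + 9 * i"])
  subgoal by simp
  subgoal by simp
  subgoal for j y s'
  proof -
    assume j: "j < n"
    have ne: "d * h mod n \<noteq> d * j mod n" if "h < j" for h
      using mult_mod_inj[OF assms(1), of h j] that j by auto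
    have lt: "x mod n < n" for x using assms by simp
    have ne2: "x mod n \<noteq> y mod n + n" for x y using lt[of x] by linarith
    have ne3: "x mod n + n \<noteq> y mod n" for x y using lt[of y] by linarith
    assume *: "(\<forall>j'<j. mem s' Beta (d * j' mod n) = mem s Alpha (j' + 1) \<and>
      mem s' Beta (d * j' mod n + n) = mem s Alpha (j' + 1)) \<and> mem s' Units = mem s Units \<and>
     mem s' Alpha = mem s Alpha \<and> outputs s' = outputs s \<and> clock s' = clock s + 9 * j"
    show ?thesis
      using * ne ne2 ne3 by (auto simp: less_Suc_eq)
  qed
  subgoal by simp
  done

text \<open>
  Invariant: every position below \<open>i\<close> or below \<open>j\<close>, other than the two candidates themselves,
  is known not to start a least rotation.
\<close>

lemma wp_least_rotation:
  assumes len: "length xs = n" and "xs \<noteq> []"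
    and f: "\<And>i. i < 2 * n \<Longrightarrow> mem s Beta i = xs ! (i mod n)"
    and "i \<noteq> j" "l \<le> n"
    and "\<And>h. h < l \<Longrightarrow> xs ! ((i + h) mod n) = xs ! ((j + h) mod n)"
    and "\<And>r. r < i \<Longrightarrow> r \<noteq> j \<Longrightarrow> \<exists>r'. rotate r' xs < rotate r xs"
    and "\<And>r. r < j \<Longrightarrow> r \<noteq> i \<Longrightarrow> \<exists>r'. rotate r' xs < rotate r xs"
  shows "wp (least_rotation n i j l) (\<lambda>r s'. r < n \<and> (\<forall>r'. rotate r xs \<le> rotate r' xs) \<and>
     (\<exists>c \<le> 12 * (3 * n - (i + j + l)) + 4. s' = s\<lparr>clock := clock s + c\<rparr>)) s"
  using assms(3-)
proof (induction "3 * n - (i + j + l)" arbitrary: i j l s rule: less_induct)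
  case less
  show ?case
  proof (cases "i < n \<and> j < n \<and> l < n")
    case False
    obtain r where r: "r < n" "\<And>r'. rotate r xs \<le> rotate r' xs"
      using exists_least_rotation assms(1,2) by metis
    \<comment> \<open>On exit there are two cases. Either both candidates are in range and
      \<open>l = n\<close>, so their rotations coincide, or one has left the range and the other is
      the only position not ruled out.\<close>
    have "min i j < n \<and> (\<forall>r'. rotate (min i j) xs \<le> rotate r' xs)"
    proof (cases "i < n \<and> j < n")
      case True
      then have eq: "rotate i xs = rotate j xs"
        using False less.prems(3,4) len by (auto simp: list_eq_iff_nth_eq nth_rotate)
      show ?thesis
      proof (cases "i < j")
        case True
        then show ?thesis using least_rotation_of_periodic[OF assms(2) True eq] less.prems(6)
            \<open>i < n \<and> j < n\<close> by (auto simp: min_def)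
      next
        case False
        then have "j < i" using less.prems(2) by simp
        then show ?thesis using least_rotation_of_periodic[OF assms(2) \<open>j < i\<close> eq[symmetric]] less.prems(5)
            \<open>i < n \<and> j < n\<close> by (auto simp: min_def)
      qed
    next
      case out: False
      have "r = j" if "n \<le> i" using less.prems(5)[of r] r that by (meson leD less_le_trans)
      moreover have "r = i" if "n \<le> j" using less.prems(6)[of r] r that by (meson leD less_le_trans)
      ultimately show ?thesis using out r by (auto simp: min_def not_less)
    qed
    moreover have "wp (least_rotation n i j l) (\<lambda>r s'. r = min i j \<and> (\<exists>c \<le> 4. s' = s\<lparr>clock := clock s + c\<rparr>)) s"
      using False by (subst least_rotation.simps) (auto simp: Let_def min_def intro: exI[of _ 4] exI[of _ 3] exI[of _ 2])
    ultimately show ?thesis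
      apply (elim wp_mono)
      apply clarsimp
      subgoal for c by (rule exI[of _ c]) simp
      done
  next
    case True
    have b: "mem s Beta (i + l) = xs ! ((i + l) mod n)" "mem s Beta (j + l) = xs ! ((j + l) mod n)"
      using True less.prems(1) by auto
    \<comment> \<open>The potential \<open>3 * n - (i + j + l)\<close> drops in every round. A round
      takes at most 12 units, the maximum being a mismatch whose new candidate hits the other one,
      so 12 per unit of potential pays for it.\<close>
    have IH: "wp (least_rotation n i' j' l') (\<lambda>r s'. r < n \<and> (\<forall>r'. rotate r xs \<le> rotate r' xs) \<and>
         (\<exists>c \<le> 12 * (3 * n - (i + j + l)) + 4. s' = s\<lparr>clock := clock s + c\<rparr>)) s1"
      if "s1 = s\<lparr>clock := clock s + e\<rparr>" "i + j + l < i' + j' + l'" "e \<le> 12" "i' \<noteq> j'" "l' \<le> n"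
        "\<And>h. h < l' \<Longrightarrow> xs ! ((i' + h) mod n) = xs ! ((j' + h) mod n)"
        "\<And>r. r < i' \<Longrightarrow> r \<noteq> j' \<Longrightarrow> \<exists>r'. rotate r' xs < rotate r xs"
        "\<And>r. r < j' \<Longrightarrow> r \<noteq> i' \<Longrightarrow> \<exists>r'. rotate r' xs < rotate r xs" for i' j' l' e s1
    proof -
      have *: "3 * n - (i' + j' + l') < 3 * n - (i + j + l)" using that(2) True by linarith
      show ?thesis
        apply (rule wp_mono[OF less.hyps[OF *]])
        using that less.prems(1) apply auto
        subgoal for r c using * by (intro exI[of _ "c + e"]) auto
        done
    qed
    consider (eq) "mem s Beta (i + l) = mem s Beta (j + l)"
      | (gt) "mem s Beta (j + l) < mem s Beta (i + l)"
      | (lt) "mem s Beta (i + l) < mem s Beta (j + l)" by linarith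
    then show ?thesis
    proof cases
      case eq
      have "xs ! ((i + h) mod n) = xs ! ((j + h) mod n)" if "h < Suc l" for h
        using that eq b less.prems(4)[of h] by (cases "h = l") auto
      then show ?thesis
        apply (subst least_rotation.simps)
        using True eq apply (simp add: Let_def)
        apply (rule IH[of _ 9 i j "Suc l"])
        using less.prems(2,5,6) by auto
    next
      case gt
      \<comment> \<open>Shifting both candidates by \<open>r - i\<close> compares \<open>r\<close>
        with a position that beats it.\<close>
      have lose: "\<exists>r'. rotate r' xs < rotate r xs" if "i \<le> r" "r \<le> i + l" for r
        using rotate_less_after_mismatch[of l xs "r - i" i j] that gt b True less.prems(4) len
        by (intro exI[of _ "j + (r - i)"]) auto
      have low: "\<exists>r'. rotate r' xs < rotate r xs" if "r < Suc (i + l)" "r \<noteq> j" for r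
        using lose[of r] less.prems(5)[of r] that by (cases "r < i") auto
      \<comment> \<open>The exception for \<open>i\<close> disappears because \<open>i\<close>
        itself has just lost. The exception for \<open>j\<close> stays, as \<open>j\<close> remains
        a candidate.\<close>
      have low2: "\<exists>r'. rotate r' xs < rotate r xs" if "r < j" for r
        using lose[of i] less.prems(6)[of r] that by (cases "r = i") auto
      show ?thesis
        apply (subst least_rotation.simps)
        using True gt apply (simp add: Let_def)
        apply (intro conjI impI)
        subgoal
          apply (rule IH[of _ 12 "Suc j" j 0])
          using low low2 by (auto simp: less_Suc_eq)
        subgoal
          apply (rule IH[of _ 11 "Suc (i + l)" j 0])
          using low low2 by (auto simp: less_Suc_eq)
        done
    next
      case lt
      have lose: "\<exists>r'. rotate r' xs < rotate r xs" if "j \<le> r" "r \<le> j + l" for r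
        using rotate_less_after_mismatch[of l xs "r - j" j i] that lt b True less.prems(4) len
        by (intro exI[of _ "i + (r - j)"]) auto
      have low: "\<exists>r'. rotate r' xs < rotate r xs" if "r < Suc (j + l)" "r \<noteq> i" for r
        using lose[of r] less.prems(6)[of r] that by (cases "r < j") auto
      have low2: "\<exists>r'. rotate r' xs < rotate r xs" if "r < i" for r
        using lose[of j] less.prems(5)[of r] that by (cases "r = j") auto
      show ?thesis
        apply (subst least_rotation.simps)
        using True lt apply (simp add: Let_def)
        apply (intro conjI impI)
        subgoal
          apply (rule IH[of _ 12 i "Suc i" 0])
          using low low2 by (auto simp: less_Suc_eq)
        subgoal
          apply (rule IH[of _ 11 i "Suc (j + l)" 0])
          using low low2 by (auto simp: less_Suc_eq)
        done
    qed
  qed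
qed

lemma wp_lex_smaller:
  assumes "length xs = n" "length ys = n" 
    and "\<And>h. h < n \<Longrightarrow> mem s Beta (r + h) = xs ! h"
    and "\<And>h. h < n \<Longrightarrow> mem s Alpha (Suc h) = ys ! h"
    and "m \<le> n" "\<And>h. h < m \<Longrightarrow> xs ! h = ys ! h"
  shows "wp (lex_smaller n r m) (\<lambda>b s'. b = (xs < ys) \<and>
     (\<exists>c \<le> 7 * (n - m) + 1. s' = s\<lparr>clock := clock s + c\<rparr>)) s"
  using assms(3-)
proof (induction "n - m" arbitrary: m s)
  case 0
  then have "xs = ys" using assms(1,2) by (auto simp: list_eq_iff_nth_eq)
  with 0 show ?case by (subst lex_smaller.simps) (auto intro!: exI[of _ 1])
next
  case (Suc q)
  have less: "xs < ys" if "xs ! m < ys ! m"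
    using that Suc assms(1,2) by (auto simp: list_less_iff_nth intro!: exI[of _ m])
  have greater: "\<not> xs < ys" if "ys ! m < xs ! m"
    using that Suc assms(1,2) by (intro less_not_sym) (auto simp: list_less_iff_nth intro!: exI[of _ m])
  have q: "q = n - Suc m" "m < n" using Suc.hyps(2) by auto
  show ?case
    apply (subst lex_smaller.simps)
    using q less greater Suc.prems(1)[of m] Suc.prems(2)[of m] apply simp
    apply (intro conjI impI)
    subgoal using q(2) by (intro exI[of _ 7]) auto
    subgoal using q(2) by (intro exI[of _ 6]) auto
    apply (rule wp_mono[OF Suc.hyps(1)[OF q(1)]])
    using q less_antisym Suc.prems apply (auto simp: less_Suc_eq)
    subgoal for c by (rule exI[of _ "c + 7"]) auto
    done
qed

section \<open>Charm bracelets and necklaces\<close>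

text \<open>This is inv(d, \<alpha>) as a relation: it states where each symbol goes, which avoids a
  modular inverse of \<open>d\<close>.\<close>

definition is_dilation :: "nat \<Rightarrow> 'a list \<Rightarrow> 'a list \<Rightarrow> bool" where
  "is_dilation d xs ys \<longleftrightarrow>
     length ys = length xs \<and> (\<forall>j<length xs. ys ! (d * j mod length xs) = xs ! j)"

lemma is_dilation_unique:
  assumes "coprime d (length xs)" "is_dilation d xs ys" "is_dilation d xs zs"
  shows "ys = zs"
proof (rule nth_equalityI)
  show "length ys = length zs" using assms(2,3) by (simp add: is_dilation_def)
  fix i assume i: "i < length ys"
  then have "i < length xs" "0 < length xs" using assms(2) by (auto simp: is_dilation_def)
  moreover from this obtain j where "j < length xs" "d * j mod length xs = i mod length xs"
    using mult_mod_surj[OF assms(1)] by blast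
  ultimately show "ys ! i = zs ! i" using assms(2,3) by (metis is_dilation_def mod_less)
qed

lemma rotate_rotate_back:
  "rotate (length xs - a mod length xs) (rotate a xs) = xs"
  "rotate a (rotate (length xs - a mod length xs) xs) = xs"
proof -
  have "(length xs - a mod length xs + a) mod length xs = 0" if "xs \<noteq> []"
  proof -
    have "a mod length xs < length xs" using that by simp
    then have "(length xs - a mod length xs + a mod length xs) mod length xs = 0" by simp
    then show ?thesis by (simp only: mod_add_right_eq)
  qed
  then have "rotate (length xs - a mod length xs + a) xs = xs" by (cases "xs = []") auto
  then show "rotate (length xs - a mod length xs) (rotate a xs) = xs"
    "rotate a (rotate (length xs - a mod length xs) xs) = xs"
    by (simp_all add: rotate_rotate add.commute)
qed

lemma affine_orbit_iff_is_dilation: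
  assumes "xs \<noteq> []"
  shows "ys \<in> affine_orbit xs \<longleftrightarrow>
    (\<exists>d < length xs. coprime d (length xs) \<and> (\<exists>a. is_dilation d xs (rotate a ys)))"
proof -
  let ?n = "length xs"
  have dil: "is_dilation d xs (rotate a ys) \<longleftrightarrow> (\<forall>j<?n. ys ! ((a + d * j) mod ?n) = xs ! j)"
    if "length ys = ?n" for a d
    using that assms by (auto simp: is_dilation_def nth_rotate mod_add_right_eq)
  have "(\<exists>a<?n. is_dilation d xs (rotate a ys)) \<longleftrightarrow> (\<exists>a. is_dilation d xs (rotate a ys))"
    if "length ys = ?n" for d
    using that assms by (metis rotate_conv_mod mod_less_divisor length_greater_0_conv)
  moreover have "length ys = ?n" if "is_dilation d xs (rotate a ys)" for a d
    using that by (simp add: is_dilation_def)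
  ultimately have "length ys = ?n \<and> (\<exists>a<?n. \<forall>j<?n. ys ! ((a + d * j) mod ?n) = xs ! j) \<longleftrightarrow>
    (\<exists>a. is_dilation d xs (rotate a ys))" for d
    using dil by metis
  then show ?thesis
    unfolding affine_orbit_def Let_def mem_Collect_eq by blast
qed

text \<open>Rotations are invertible, so strings with a rotation that is a dilation of
  \<open>xs\<close> are the rotations of dilations of \<open>xs\<close>. This is the form that the
  program tests.\<close>

lemma charm_bracelets_iff:
  assumes "xs \<in> strings k n" "1 \<le> n"
  shows "xs \<in> charm_bracelets k n \<longleftrightarrow>
    (\<forall>d<n. coprime d n \<longrightarrow> (\<forall>ys. is_dilation d xs ys \<longrightarrow> (\<forall>r. xs \<le> rotate r ys)))"
    (is "?L \<longleftrightarrow> ?R")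
proof -
  have n: "length xs = n" "xs \<noteq> []" using assms by (auto simp: strings_def)
  have "(\<forall>ys. (\<exists>a. is_dilation d xs (rotate a ys)) \<longrightarrow> xs \<le> ys) \<longleftrightarrow>
    (\<forall>ys. is_dilation d xs ys \<longrightarrow> (\<forall>r. xs \<le> rotate r ys))" for d
    by (metis rotate_rotate_back)
  moreover have "xs \<in> charm_bracelets k n \<longleftrightarrow>
    (\<forall>d<n. coprime d n \<longrightarrow> (\<forall>ys. (\<exists>a. is_dilation d xs (rotate a ys)) \<longrightarrow> xs \<le> ys))"
    using assms(1) unfolding charm_bracelets_def mem_Collect_eq Ball_def affine_orbit_iff_is_dilation[OF n(2)] n(1)
    by blast
  ultimately show ?thesis by simp
qed

definition necklace :: "'a::linorder list \<Rightarrow> bool" where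
  "necklace xs \<longleftrightarrow> (\<forall>r. xs \<le> rotate r xs)"

definition necklaces :: "nat \<Rightarrow> nat \<Rightarrow> nat list set" where
  "necklaces k n = {xs \<in> strings k n. necklace xs}"

lemma is_dilation_unit:
  assumes "xs \<noteq> []"
  obtains d where "d < length xs" "coprime d (length xs)" "is_dilation d xs xs"
proof (cases "length xs = 1")
  case True
  \<comment> \<open>For length 1 the unit residue is 0, as 1 is not below the length.\<close>
  then show ?thesis using that[of 0] by (simp add: is_dilation_def)
next
  case False
  then have "1 < length xs" using assms by (cases xs) auto
  then show ?thesis using that[of 1] by (simp add: is_dilation_def)
qed

lemma charm_bracelets_subset_necklaces:
  assumes "1 \<le> n"
  shows "charm_bracelets k n \<subseteq> necklaces k n"
proof
  fix xs assume xs: "xs \<in> charm_bracelets k n"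
  then have s: "xs \<in> strings k n" by (simp add: charm_bracelets_def)
  then have n: "length xs = n" "xs \<noteq> []" using assms by (auto simp: strings_def)
  then have "necklace xs"
    using xs is_dilation_unit[OF n(2)]
    unfolding necklace_def charm_bracelets_iff[OF s assms] by blast
  then show "xs \<in> necklaces k n" using s by (simp add: necklaces_def)
qed

text \<open>The stored units are positive, whereas the orbit also admits \<open>d = 0\<close> when
  \<open>n = 1\<close>. There the only dilation is \<open>xs\<close> itself, and being a necklace
  covers it.\<close>

lemma necklace_charm_bracelets_iff:
  assumes "xs \<in> necklaces k n" "1 \<le> n"
  shows "xs \<in> charm_bracelets k n \<longleftrightarrow>
    (\<forall>d. 1 \<le> d \<and> d < n \<and> coprime d n \<longrightarrow> (\<forall>ys. is_dilation d xs ys \<longrightarrow> (\<forall>r. xs \<le> rotate r ys)))"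
proof -
  have s: "xs \<in> strings k n" "necklace xs" "length xs = n" using assms by (auto simp: necklaces_def strings_def)
  have "ys = xs" if "n = 1" "is_dilation 0 xs ys" for ys
    using that s(3) by (auto simp: is_dilation_def list_eq_iff_nth_eq)
  then have "xs \<le> rotate r ys" if "0 < n" "coprime 0 n" "is_dilation 0 xs ys" for ys r
    using s(2) that by (auto simp: necklace_def)
  then show ?thesis
    unfolding charm_bracelets_iff[OF s(1) assms(2)] by (metis One_nat_def Suc_leI not_gr_zero)
qed

subsection \<open>Necklaces per charm bracelet\<close>

lemma affine_orbit_strings: 
  assumes "xs \<in> strings k n" "1 \<le> n" "ys \<in> affine_orbit xs"
  shows "ys \<in> strings k n"
proof -
  have n: "length xs = n" "set xs \<subseteq> {..<k}" using assms(1) by (auto simp: strings_def)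
  obtain a d where *: "length ys = n" "coprime d n" "\<And>j. j < n \<Longrightarrow> ys ! ((a + d * j) mod n) = xs ! j"
    using assms(3) n(1) by (auto simp: affine_orbit_def)
  have "ys ! i < k" if i: "i < n" for i
  proof -
    \<comment> \<open>Solves \<open>a + d * j = i\<close> modulo \<open>n\<close>;
      \<open>n - a mod n\<close> plays the role of \<open>- a\<close>.\<close>
    obtain j where j: "j < n" "d * j mod n = (i + (n - a mod n)) mod n"
      using mult_mod_surj[OF *(2)] assms(2) by (metis less_le_trans zero_less_one)
    have "(a + d * j) mod n = (a mod n + (i + (n - a mod n))) mod n"
      using j(2) by (metis mod_add_eq mod_mod_trivial)
    also have "a mod n + (i + (n - a mod n)) = i + n"
      using mod_less_divisor[of n a] assms(2) by linarith
    finally have "(a + d * j) mod n = i" using i by simp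
    then have "ys ! i = xs ! j" using *(3)[OF j(1)] by simp
    then show ?thesis using n j(1) by (metis lessThan_iff nth_mem subsetD)
  qed
  then show ?thesis using *(1) by (auto simp: strings_def in_set_conv_nth)
qed

lemma affine_orbit_refl: "xs \<noteq> [] \<Longrightarrow> xs \<in> affine_orbit xs"
proof -
  assume ne: "xs \<noteq> []"
  obtain d where "d < length xs" "coprime d (length xs)" "is_dilation d xs (rotate 0 xs)"
    using is_dilation_unit[OF ne] by auto
  then show ?thesis unfolding affine_orbit_iff_is_dilation[OF ne] by blast
qed

text \<open>Affine maps compose: the new offset is \<open>a' + d' * a\<close> and the new multiplier
  \<open>d' * d\<close>, both reduced because the orbit asks for representatives below
  \<open>n\<close>.\<close>

lemma affine_orbit_trans:
  assumes "ys \<in> affine_orbit xs" "zs \<in> affine_orbit ys"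
  shows "zs \<in> affine_orbit xs"
proof -
  define n where "n = length xs"
  obtain a d where 1: "length ys = n" "a < n" "coprime d n" "\<And>j. j < n \<Longrightarrow> ys ! ((a + d * j) mod n) = xs ! j"
    using assms(1) unfolding affine_orbit_def Let_def n_def mem_Collect_eq by blast
  obtain a' d' where 2: "length zs = n" "coprime d' n" "\<And>j. j < n \<Longrightarrow> zs ! ((a' + d' * j) mod n) = ys ! j"
    using assms(2) unfolding affine_orbit_def Let_def 1(1) mem_Collect_eq by blast
  have "zs ! (((a' + d' * a) mod n + (d' * d mod n) * j) mod n) = xs ! j" if "j < n" for j
  proof -
    have "[(a' + d' * a) mod n + (d' * d mod n) * j = (a' + d' * a) + (d' * d) * j] (mod n)"
      by (intro cong_add cong_mult) (auto simp: cong_def)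
    moreover have "[a' + d' * ((a + d * j) mod n) = a' + d' * (a + d * j)] (mod n)"
      by (intro cong_add cong_mult) (auto simp: cong_def)
    ultimately have "((a' + d' * a) mod n + (d' * d mod n) * j) mod n = (a' + d' * ((a + d * j) mod n)) mod n"
      by (simp add: cong_def algebra_simps)
    then show ?thesis using 2(3)[of "(a + d * j) mod n"] 1(4)[OF that] that by simp
  qed
  moreover have "coprime (d' * d mod n) n" using 1 2 by simp
  moreover have "(a' + d' * a) mod n < n" "d' * d mod n < n" using 1(2) by auto
  ultimately show ?thesis
    using 2(1) unfolding affine_orbit_def Let_def n_def[symmetric] by blast
qed

lemma finite_strings: "finite (strings k n)"
  unfolding strings_def using finite_lists_length_eq[of "{..<k}" n] by (simp add: conj_commute)

text \<open>The minimum of the finite orbit works: by transitivity its own orbit lies inside the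
  original one.\<close>

lemma charm_bracelet_in_orbit:
  assumes "xs \<in> strings k n" "1 \<le> n"
  obtains ys where "ys \<in> affine_orbit xs" "ys \<in> charm_bracelets k n"
proof -
  have ne: "xs \<noteq> []" using assms by (auto simp: strings_def)
  have fin: "finite (affine_orbit xs)"
    using affine_orbit_strings[OF assms] finite_strings by (meson finite_subset subsetI)
  have M: "Min (affine_orbit xs) \<in> affine_orbit xs"
    using fin affine_orbit_refl[OF ne] by (intro Min_in) auto
  moreover have "Min (affine_orbit xs) \<in> charm_bracelets k n"
    using affine_orbit_strings[OF assms M] affine_orbit_trans[OF M] fin
    by (auto simp: charm_bracelets_def)
  ultimately show ?thesis using that by blast
qed

text \<open>Two strings sent to the same \<open>zs\<close> with the same multiplier differ by a
  rotation, namely by \<open>c\<close> with \<open>d * c = a - b\<close> modulo \<open>n\<close>.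
  Necklaces that are rotations of each other coincide.\<close>

lemma necklace_with_dilation_unique:
  assumes "necklace xs" "necklace ys" "length xs = n" "length ys = n" "coprime d n" "0 < n"
    and "\<And>j. j < n \<Longrightarrow> zs ! ((a + d * j) mod n) = xs ! j"
    and "\<And>j. j < n \<Longrightarrow> zs ! ((b + d * j) mod n) = ys ! j"
  shows "xs = ys"
proof -
  have "ys \<le> xs" if "necklace ys" "length xs = n" "length ys = n"
    "\<And>j. j < n \<Longrightarrow> zs ! ((a + d * j) mod n) = xs ! j"
    "\<And>j. j < n \<Longrightarrow> zs ! ((b + d * j) mod n) = ys ! j" for a b xs ys
  proof -
    obtain c where c: "d * c mod n = (a + (n - b mod n)) mod n"
      using mult_mod_surj[OF assms(5,6)] by metis
    have "xs ! j = ys ! ((c + j) mod n)" if "j < n" for j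
    proof -
      have "[b + d * ((c + j) mod n) = b + (d * c + d * j)] (mod n)"
        by (simp add: cong_def mod_add_right_eq mod_mult_right_eq flip: distrib_left)
          (metis mod_add_right_eq mod_mult_right_eq)
      also have "[b + (d * c + d * j) = b mod n + (a + (n - b mod n) + d * j)] (mod n)"
        using c by (intro cong_add cong_refl) (auto simp: cong_def)
      also have "b mod n + (a + (n - b mod n) + d * j) = a + d * j + n"
        using mod_less_divisor[OF assms(6), of b] by linarith
      finally have "(b + d * ((c + j) mod n)) mod n = (a + d * j) mod n"
        by (simp add: cong_def)
      then show ?thesis
        using \<open>\<And>j. j < n \<Longrightarrow> zs ! ((a + d * j) mod n) = xs ! j\<close>[OF that] 
          \<open>\<And>j. j < n \<Longrightarrow> zs ! ((b + d * j) mod n) = ys ! j\<close>[of "(c + j) mod n"] assms(6) by simp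
    qed
    then have "xs = rotate c ys" using that(2,3) by (auto simp: list_eq_iff_nth_eq nth_rotate)
    then show ?thesis using that(1) by (simp add: necklace_def)
  qed
  from this[of ys xs a b] this[of xs ys b a] show ?thesis using assms by auto
qed

lemma card_necklaces_le:
  assumes "1 \<le> n"
  shows "card (necklaces k n) \<le> n * card (charm_bracelets k n)"
proof -
  define R where "R xs d zs \<longleftrightarrow> necklace xs \<and> length xs = n \<and> coprime d n \<and>
    (\<exists>a. \<forall>j<n. zs ! ((a + d * j) mod n) = xs ! j)" for xs zs :: "nat list" and d
  have uniq: "xs = ys" if "R xs d zs" "R ys d zs" for xs ys d zs
    using that assms necklace_with_dilation_unique[of xs ys n d zs] unfolding R_def by auto
  \<comment> \<open>A necklace is recovered from a charm bracelet in its orbit and the multiplier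
    leading there, which gives at most \<open>n\<close> necklaces per bracelet.\<close>
  have "necklaces k n \<subseteq> (\<lambda>(d, zs). THE xs. R xs d zs) ` ({..<n} \<times> charm_bracelets k n)"
  proof
    fix xs assume xs: "xs \<in> necklaces k n"
    then have s: "xs \<in> strings k n" "length xs = n" by (auto simp: necklaces_def strings_def)
    obtain zs where zs: "zs \<in> affine_orbit xs" "zs \<in> charm_bracelets k n"
      using charm_bracelet_in_orbit[OF s(1) assms] .
    then obtain d where d: "d < n" "R xs d zs"
      using s(2) xs unfolding affine_orbit_def R_def necklaces_def by auto
    then have "xs = (THE xs. R xs d zs)" using uniq by (metis the_equality)
    then show "xs \<in> (\<lambda>(d, zs). THE xs. R xs d zs) ` ({..<n} \<times> charm_bracelets k n)"
      using d(1) zs(2) by force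
  qed
  moreover have fin: "finite (charm_bracelets k n)"
    using finite_strings[of k n] by (auto simp: charm_bracelets_def)
  ultimately have "card (necklaces k n) \<le> card ({..<n} \<times> charm_bracelets k n)"
    using surj_card_le by (metis finite_SigmaI finite_lessThan)
  then show ?thesis by (simp add: card_cartesian_product)
qed

section \<open>Prenecklaces\<close>

text \<open>No suffix is lexicographically below the prefix of its length; these words are known as
  the prefixes of necklaces. The symbolwise form passes to prefixes at once.\<close>

definition prenecklace :: "'a::linorder list \<Rightarrow> bool" where
  "prenecklace w \<longleftrightarrow> (\<forall>i l. i + l < length w \<longrightarrow> (\<forall>j<l. w ! (i + j) = w ! j) \<longrightarrow> w ! l \<le> w ! (i + l))"

lemma prenecklaceD:
  "prenecklace w \<Longrightarrow> i + l < length w \<Longrightarrow> \<forall>j<l. w ! (i + j) = w ! j \<Longrightarrow> w ! l \<le> w ! (i + l)"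
  unfolding prenecklace_def by blast

text \<open>
  The invariant of the parameter \<open>p\<close> of the recursion: the prefix of length \<open>p\<close> is a Lyndon word and
  \<open>p\<close> is a period. The maximum admits the initial call, where \<open>w = []\<close> and \<open>p = 1\<close>. Below,
  \<open>0 # w\<close> is \<open>w\<close> with the sentinel cell, so that \<open>(0 # w) ! (length w + 1 - p)\<close> is \<open>a\<^bsub>t-p\<^esub>\<close> for
  \<open>t = length w + 1\<close>.
\<close>

definition lyndon_period :: "nat list \<Rightarrow> nat \<Rightarrow> bool" where
  "lyndon_period w p \<longleftrightarrow> 1 \<le> p \<and> p \<le> max 1 (length w) \<and>
     (\<forall>i. 0 < i \<and> i < p \<longrightarrow> (\<exists>l. i + l < p \<and> (\<forall>j<l. w ! (i + j) = w ! j) \<and> w ! l < w ! (i + l))) \<and>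
     (\<forall>i. p \<le> i \<and> i < length w \<longrightarrow> w ! i = w ! (i - p))"

lemma lyndon_periodI:
  assumes "1 \<le> p" "p \<le> max 1 (length w)"
    and "\<And>i. 0 < i \<Longrightarrow> i < p \<Longrightarrow> \<exists>l. i + l < p \<and> (\<forall>j<l. w ! (i + j) = w ! j) \<and> w ! l < w ! (i + l)"
    and "\<And>i. p \<le> i \<Longrightarrow> i < length w \<Longrightarrow> w ! i = w ! (i - p)"
  shows "lyndon_period w p"
  unfolding lyndon_period_def
proof (intro conjI allI impI)
  show "\<exists>l. i + l < p \<and> (\<forall>j<l. w ! (i + j) = w ! j) \<and> w ! l < w ! (i + l)" if "0 < i \<and> i < p" for i
    using assms(3) that by blast
  show "w ! i = w ! (i - p)" if "p \<le> i \<and> i < length w" for i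
    using that by (intro assms(4)) auto
qed (use assms(1,2) in auto)

lemma lyndon_period_bounds:
  assumes "lyndon_period w p" "w \<noteq> []"
  shows "1 \<le> p" "p \<le> length w"
proof -
  have "1 \<le> length w" using assms(2) by (cases w) auto
  then show "1 \<le> p" "p \<le> length w" using assms(1) unfolding lyndon_period_def by auto
qed

lemma lyndon_period_less:
  assumes "lyndon_period w p" "0 < i" "i < p"
  obtains l where "i + l < p" "\<forall>j<l. w ! (i + j) = w ! j" "w ! l < w ! (i + l)"
proof -
  have "\<exists>l. i + l < p \<and> (\<forall>j<l. w ! (i + j) = w ! j) \<and> w ! l < w ! (i + l)"
    using assms by (simp add: lyndon_period_def)
  then show ?thesis using that by metis
qed

lemma lyndon_period_nth_diff:
  "lyndon_period w p \<Longrightarrow> p \<le> i \<Longrightarrow> i < length w \<Longrightarrow> w ! i = w ! (i - p)"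
  unfolding lyndon_period_def by blast

lemma lyndon_period_Nil: "lyndon_period [] 1"
  by (auto simp: lyndon_period_def)

text \<open>A start \<open>i\<close> at or beyond \<open>p\<close> is moved back by the period. For
  \<open>0 < i < p\<close> the Lyndon prefix has its first mismatch with the shifted copy at some
  \<open>m\<close>, where the shifted copy is larger; a match of length \<open>l\<close> forces
  \<open>l \<le> m\<close>.\<close>

lemma lyndon_period_prenecklace:
  assumes "lyndon_period w p"
  shows "prenecklace w"
  unfolding prenecklace_def
proof (intro allI impI)
  fix i l assume "i + l < length w" "\<forall>j<l. w ! (i + j) = w ! j"
  then show "w ! l \<le> w ! (i + l)"
  proof (induction i rule: less_induct)
    case (less i)
    consider "i = 0" | "0 < i" "i < p" | "p \<le> i" by linarith
    then show ?case
    proof cases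
      case 2
      then obtain m where m: "\<forall>j<m. w ! (i + j) = w ! j" "w ! m < w ! (i + m)"
        using lyndon_period_less[OF assms 2] by blast
      then show ?thesis using less.prems(2) by (metis less_irrefl linorder_neqE_nat order_eq_refl less_imp_le)
    next
      case 3
      have shift: "w ! (i + j) = w ! (i - p + j)" if "j \<le> l" for j
      proof -
        have "w ! (i + j) = w ! (i + j - p)"
          using 3 that less.prems(1) by (intro lyndon_period_nth_diff[OF assms]) auto
        then show ?thesis using 3 by simp
      qed
      have "0 < p" using assms by (simp add: lyndon_period_def)
      then have "w ! l \<le> w ! (i - p + l)"
        using 3 less.prems shift by (intro less.IH) auto
      then show ?thesis using shift[of l] by simp
    qed simp
  qed
qed

lemma lyndon_period_append_same:
  assumes w: "lyndon_period w p"
  shows "lyndon_period (w @ [(0 # w) ! (length w + 1 - p)]) p"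
proof (cases "w = []")
  case True
  then show ?thesis using assms by (auto simp: lyndon_period_def)
next
  case False
  then have p: "1 \<le> p" "p \<le> length w" using lyndon_period_bounds[OF assms(1)] by auto
  have "\<exists>l. i + l < p \<and> (\<forall>j<l. (w @ [b]) ! (i + j) = (w @ [b]) ! j) \<and> (w @ [b]) ! l < (w @ [b]) ! (i + l)"
    if i: "0 < i" "i < p" for i b
  proof -
    obtain l where "i + l < p" "\<forall>j<l. w ! (i + j) = w ! j" "w ! l < w ! (i + l)"
      using lyndon_period_less[OF assms i] by blast
    then show ?thesis using p by (intro exI[of _ l]) (auto simp: nth_append)
  qed
  moreover have "(w @ [(0 # w) ! (length w + 1 - p)]) ! i = (w @ [(0 # w) ! (length w + 1 - p)]) ! (i - p)"
    if i: "p \<le> i" "i < length w + 1" for i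
  proof (cases "i < length w")
    case True
    then show ?thesis using lyndon_period_nth_diff[OF assms i(1)] by (simp add: nth_append)
  next
    case False
    then have "i = length w" using i by simp
    then show ?thesis using p by (simp add: nth_append Suc_diff_le)
  qed
  ultimately show ?thesis using p by (intro lyndon_periodI) auto
qed

text \<open>A proper suffix of \<open>w\<close> either exceeds the prefix already inside
  \<open>w\<close>, or equals the prefix of its length. In the second case the new symbol
  \<open>b\<close> decides, as it exceeds the symbol that the period would dictate.\<close>

lemma lyndon_period_append_greater:
  assumes "lyndon_period w p" "(0 # w) ! (length w + 1 - p) < b"
  shows "lyndon_period (w @ [b]) (length w + 1)"
proof (cases "w = []")
  case True
  then show ?thesis by (auto simp: lyndon_period_def)
next
  case False
  then have p: "1 \<le> p" "p \<le> length w" using lyndon_period_bounds[OF assms(1)] by auto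
  let ?m = "length w"
  have b: "w ! (?m - p) < b" using assms(2) p by (simp add: Suc_diff_le)
  have "\<exists>l. i + l < ?m + 1 \<and> (\<forall>j<l. (w @ [b]) ! (i + j) = (w @ [b]) ! j) \<and> (w @ [b]) ! l < (w @ [b]) ! (i + l)"
    if i: "0 < i" "i < ?m + 1" for i
  proof (cases "\<exists>l. i + l < ?m \<and> (\<forall>j<l. w ! (i + j) = w ! j) \<and> w ! l < w ! (i + l)")
    case True
    then obtain l where "i + l < ?m" "\<forall>j<l. w ! (i + j) = w ! j" "w ! l < w ! (i + l)" by blast
    then show ?thesis by (intro exI[of _ l]) (auto simp: nth_append)
  next
    case False
    have eq: "w ! (i + l) = w ! l" if "i + l < ?m" for l
      using that
    proof (induction l rule: less_induct)
      case (less l)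
      then have "\<forall>j<l. w ! (i + j) = w ! j" by auto
      then show ?case
        using less.prems False lyndon_period_prenecklace[OF assms(1)]
        unfolding prenecklace_def by (metis order.antisym not_less)
    qed
    \<comment> \<open>A start inside the Lyndon prefix would have a strict win within
      \<open>w\<close>, which is excluded here.\<close>
    have "p \<le> i"
    proof (rule ccontr)
      assume "\<not> p \<le> i"
      then obtain l where "i + l < p" "\<forall>j<l. w ! (i + j) = w ! j" "w ! l < w ! (i + l)"
        using lyndon_period_less[OF assms(1) i(1)] not_less by blast
      moreover from this have "i + l < ?m" using p by linarith
      ultimately show False using False by blast
    qed
    \<comment> \<open>The factor starting at \<open>i - p\<close> agrees with the prefix on
      \<open>?m - i\<close> symbols, so the prenecklace property bounds the next symbol, which sits
      at \<open>?m - p\<close>.\<close>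
    have "w ! (?m - i) \<le> w ! (i - p + (?m - i))"
    proof -
      have "w ! (i - p + j) = w ! j" if "j < ?m - i" for j
      proof -
        have "w ! (i + j) = w ! (i + j - p)"
          using that \<open>p \<le> i\<close> by (intro lyndon_period_nth_diff[OF assms(1)]) auto
        then show ?thesis using eq[of j] that \<open>p \<le> i\<close> by simp
      qed
      moreover have "i - p + (?m - i) < ?m" using p i \<open>p \<le> i\<close> by auto
      ultimately show ?thesis
        using lyndon_period_prenecklace[OF assms(1)] unfolding prenecklace_def by blast
    qed
    also have "i - p + (?m - i) = ?m - p" using \<open>p \<le> i\<close> i by simp
    finally have "w ! (?m - i) < b" using b by simp
    then show ?thesis using i eq by (intro exI[of _ "?m - i"]) (auto simp: nth_append)
  qed
  then show ?thesis by (intro lyndon_periodI) auto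
qed

text \<open>The suffix starting at \<open>p\<close> repeats the prefix, so its last symbol must not
  be smaller. Hence starting the loop at this value loses no prenecklace.\<close>

lemma prenecklace_append_ge:
  assumes "lyndon_period w p" "prenecklace (w @ [b])"
  shows "(0 # w) ! (length w + 1 - p) \<le> b"
proof (cases "w = []")
  case True
  then show ?thesis using assms by (auto simp: lyndon_period_def)
next
  case False
  then have p: "1 \<le> p" "p \<le> length w" using lyndon_period_bounds[OF assms(1)] by auto
  have "(w @ [b]) ! (p + j) = (w @ [b]) ! j" if "j < length w - p" for j
  proof -
    have "p + j < length w" using that by linarith
    then show ?thesis using lyndon_period_nth_diff[OF assms(1), of "p + j"] by (simp add: nth_append)
  qed
  then have "(w @ [b]) ! (length w - p) \<le> (w @ [b]) ! (p + (length w - p))"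
    using p by (intro prenecklaceD[OF assms(2)]) auto
  moreover have "length w - p < length w" using p by linarith
  ultimately show ?thesis using p by (simp add: nth_append Suc_diff_le)
qed

lemma prenecklace_take: "prenecklace w \<Longrightarrow> prenecklace (take m w)"
  unfolding prenecklace_def by simp

lemma necklace_prenecklace:
  assumes "necklace w"
  shows "prenecklace w"
  unfolding prenecklace_def
proof (intro allI impI)
  fix i l assume *: "i + l < length w" "\<forall>j<l. w ! (i + j) = w ! j"
  have "w \<le> rotate i w" using assms by (simp add: necklace_def)
  moreover have "\<forall>j<l. w ! j = rotate i w ! j" using * by (simp add: nth_rotate)
  ultimately have "w ! l \<le> rotate i w ! l"
    using *(1) by (simp add: list_le_iff_nth)
  then show "w ! l \<le> w ! (i + l)" using * by (simp add: nth_rotate)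
qed

text \<open>If \<open>p\<close> divides the length, rotations depend only on \<open>r mod p\<close>
  and the Lyndon prefix decides. Otherwise, moving the incomplete last period to the front gives a
  strictly smaller rotation.\<close>

lemma necklace_iff_period_dvd:
  assumes "lyndon_period w p" "w \<noteq> []"
  shows "necklace w \<longleftrightarrow> p dvd length w"
proof
  let ?n = "length w"
  have p: "1 \<le> p" "p \<le> length w" using lyndon_period_bounds[OF assms] by auto
  have per: "w ! i = w ! (i mod p)" if "i < ?n" for i
    using that
  proof (induction i rule: less_induct)
    case (less i)
    show ?case
    proof (cases "i < p")
      case False
      then have "w ! i = w ! (i - p)" using less.prems by (intro lyndon_period_nth_diff[OF assms(1)]) auto
      also have "\<dots> = w ! ((i - p) mod p)" using less p False by auto
      finally show ?thesis using False by (simp add: le_mod_geq)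
    qed simp
  qed
  have strict: "\<exists>l. i + l < p \<and> (\<forall>j<l. w ! (i + j) = w ! j) \<and> w ! l < w ! (i + l)" if "0 < i" "i < p" for i
    using lyndon_period_less[OF assms(1) that] by blast
  show "necklace w" if dvd: "p dvd ?n"
    unfolding necklace_def
  proof
    fix r
    have rot: "rotate r w ! j = w ! ((r mod p + j) mod p)" if "j < ?n" for j
      using that per[of "(r + j) mod ?n"] dvd assms(2) by (simp add: nth_rotate mod_mod_cancel mod_simps)
    show "w \<le> rotate r w"
    proof (cases "r mod p = 0")
      case True
      then have "rotate r w = w" using rot per by (auto simp: list_eq_iff_nth_eq)
      then show ?thesis by simp
    next
      case False
      then obtain l where l: "r mod p + l < p" "\<forall>j<l. w ! (r mod p + j) = w ! j" "w ! l < w ! (r mod p + l)"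
        using strict[of "r mod p"] p by auto
      have "w ! j = rotate r w ! j" if "j < l" for j
        using rot[of j] l that p by auto
      moreover have "w ! l < rotate r w ! l" using rot[of l] l p by auto
      ultimately have "w < rotate r w" using l p by (auto simp: list_less_iff_nth intro!: exI[of _ l])
      then show ?thesis by simp
    qed
  qed
  show "p dvd ?n" if neck: "necklace w"
  proof (rule ccontr)
    define r where "r = ?n mod p"
    assume "\<not> p dvd ?n"
    then have r: "0 < r" "r < p" using p by (auto simp: r_def dvd_eq_mod_eq_0)
    then obtain l where l: "r + l < p" "\<forall>j<l. w ! (r + j) = w ! j" "w ! l < w ! (r + l)"
      using strict by blast
    have q: "?n - r + r = ?n" "p dvd ?n - r" by (auto simp: r_def minus_mod_eq_mult_div)
    \<comment> \<open>As \<open>?n - r\<close> is a multiple of \<open>p\<close>, the last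
      \<open>r\<close> symbols equal the first \<open>r\<close>, and after them the rotation reads
      \<open>w\<close> from its start.\<close>
    have rot: "rotate (?n - r) w ! j = (if j < r then w ! j else w ! (j - r))" if "j < p" for j
    proof (cases "j < r")
      case True
      then have "rotate (?n - r) w ! j = w ! (?n - r + j)" using q that p by (simp add: nth_rotate)
      also have "\<dots> = w ! ((?n - r + j) mod p)" using True q by (intro per) simp
      also have "(?n - r + j) mod p = j" using q(2) that by (auto elim!: dvdE)
      finally show ?thesis using True by simp
    next
      case False
      then have "?n - r + j = ?n + (j - r)" using q(1) by linarith
      then have "(?n - r + j) mod ?n = j - r" using that p by (simp only: mod_add_self1) simp
      then show ?thesis using False that p by (simp only: nth_rotate[of j w] if_False)
    qed
    have "rotate (?n - r) w ! j = w ! j" if "j < r + l" for j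
      using rot[of j] l(1,2) that by (cases "j < r") (auto dest: spec[of _ "j - r"])
    moreover have "rotate (?n - r) w ! (r + l) < w ! (r + l)" using rot[of "r + l"] l by auto
    ultimately have "rotate (?n - r) w < w" using l(1) p by (auto simp: list_less_iff_nth intro!: exI[of _ "r + l"])
    then show False using neck by (auto simp: necklace_def not_less[symmetric])
  qed
qed

section \<open>The recursion tree\<close>

text \<open>Pure counterpart of the recursion: the calls in their order, each recorded by the string
  built so far and \<open>p\<close>, with \<open>t = length w + 1\<close>. Outputs and running time
  are both read off from this list.\<close>

function fkm_nodes :: "nat \<Rightarrow> nat \<Rightarrow> nat list \<Rightarrow> nat \<Rightarrow> (nat list \<times> nat) list" where
  "fkm_nodes k n w p = (w, p) # (if n \<le> length w then [] else
     concat (map (\<lambda>i. fkm_nodes k n (w @ [i]) (if i = (0 # w) ! (length w + 1 - p) then p else length w + 1))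
       [(0 # w) ! (length w + 1 - p)..<k]))"
  by pat_completeness auto
termination by (relation "measure (\<lambda>(k, n, w, p). n - length w)") auto

declare fkm_nodes.simps [simp del]

lemma set_fkm_nodes:
  assumes "length w < n"
  shows "set (fkm_nodes k n w p) = insert (w, p) (\<Union>i \<in> set [(0 # w) ! (length w + 1 - p)..<k].
    set (fkm_nodes k n (w @ [i]) (if i = (0 # w) ! (length w + 1 - p) then p else length w + 1)))"
  using assms by (subst fkm_nodes.simps) (simp del: if_split set_upt)

lemma lyndon_period_child:
  assumes "lyndon_period w p" "(0 # w) ! (length w + 1 - p) \<le> i"
  shows "lyndon_period (w @ [i]) (if i = (0 # w) ! (length w + 1 - p) then p else length w + 1)"
proof (cases "i = (0 # w) ! (length w + 1 - p)")
  case True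
  then show ?thesis using lyndon_period_append_same[OF assms(1)] by simp
next
  case False
  then show ?thesis using lyndon_period_append_greater[OF assms(1)] assms(2) by simp
qed

lemma fkm_nodes_sound:
  assumes "lyndon_period w p" "length w \<le> n" "set w \<subseteq> {..<k}" "(v, q) \<in> set (fkm_nodes k n w p)"
  shows "lyndon_period v q \<and> length w \<le> length v \<and> length v \<le> n \<and> set v \<subseteq> {..<k} \<and> take (length w) v = w"
  using assms
proof (induction k n w p rule: fkm_nodes.induct)
  case (1 k n w p)
  let ?x = "(0 # w) ! (length w + 1 - p)"
  show ?case
  proof (cases "(v, q) = (w, p)")
    case True
    then show ?thesis using "1.prems" by simp
  next
    case False
    then have n: "length w < n" using "1.prems"(4) by (subst (asm) fkm_nodes.simps) (auto split: if_splits)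
    then obtain i where i: "?x \<le> i" "i < k"
      "(v, q) \<in> set (fkm_nodes k n (w @ [i]) (if i = ?x then p else length w + 1))"
      using "1.prems"(4) False by (subst (asm) fkm_nodes.simps) (auto simp del: if_split)
    have "lyndon_period v q \<and> length (w @ [i]) \<le> length v \<and> length v \<le> n \<and> set v \<subseteq> {..<k} \<and>
      take (length (w @ [i])) v = w @ [i]"
      using i n "1.prems"(3) lyndon_period_child[OF "1.prems"(1) i(1)]
      by (intro "1.IH") auto
    then show ?thesis using n by (metis append_eq_conv_conj append_take_drop_id append.assoc length_append le_add1 le_trans)
  qed
qed

lemma distinct_concat_map:
  assumes "distinct xs" "\<And>x. x \<in> set xs \<Longrightarrow> distinct (f x)"
    and "\<And>x y. x \<in> set xs \<Longrightarrow> y \<in> set xs \<Longrightarrow> x \<noteq> y \<Longrightarrow> set (f x) \<inter> set (f y) = {}"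
  shows "distinct (concat (map f xs))"
  using assms
proof (induction xs)
  case (Cons x xs)
  then have "set (f x) \<inter> set (f y) = {}" if "y \<in> set xs" for y using that by auto
  then have "set (f x) \<inter> set (concat (map f xs)) = {}" by auto
  moreover have "distinct (concat (map f xs))" using Cons by auto
  ultimately show ?case using Cons.prems(2) by simp
qed simp

text \<open>Words below different children differ at index \<open>length w\<close>, and they are all
  longer than \<open>w\<close>.\<close>

lemma fkm_nodes_distinct:
  assumes "lyndon_period w p" "length w \<le> n" "set w \<subseteq> {..<k}"
  shows "distinct (map fst (fkm_nodes k n w p))"
  using assms
proof (induction k n w p rule: fkm_nodes.induct)
  case (1 k n w p)
  let ?x = "(0 # w) ! (length w + 1 - p)"
  let ?ch = "\<lambda>i. fkm_nodes k n (w @ [i]) (if i = ?x then p else length w + 1)"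
  show ?case
  proof (cases "n \<le> length w")
    case True
    then show ?thesis by (subst fkm_nodes.simps) simp
  next
    case False
    have IH: "distinct (map fst (?ch i))" if "i \<in> set [?x..<k]" for i
      using False "1.prems"(3) that lyndon_period_child[OF "1.prems"(1), of i]
      by (intro "1.IH") auto
    have ext: "take (length w + 1) v = w @ [i]" if i: "i \<in> set [?x..<k]" and v: "v \<in> fst ` set (?ch i)" for i v
    proof -
      obtain q where q: "(v, q) \<in> set (?ch i)" using v by force
      have "?x \<le> i" "i < k" using i by auto
      then have "take (length (w @ [i])) v = w @ [i]"
        using fkm_nodes_sound[OF lyndon_period_child[OF "1.prems"(1)] _ _ q] False "1.prems"(3)
        by auto
      then show ?thesis by simp
    qed
    have "distinct (concat (map (\<lambda>i. map fst (?ch i)) [?x..<k]))"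
    proof (rule distinct_concat_map)
      fix i j assume "i \<in> set [?x..<k]" "j \<in> set [?x..<k]" "i \<noteq> j"
      then show "set (map fst (?ch i)) \<inter> set (map fst (?ch j)) = {}"
        using ext[of i] ext[of j] unfolding set_map disjoint_iff by (metis append1_eq_conv)
    qed (use IH in auto)
    moreover have "w \<notin> fst ` set (?ch i)" if "i \<in> set [?x..<k]" for i
    proof
      assume "w \<in> fst ` set (?ch i)"
      from ext[OF that this] show False by simp
    qed
    ultimately show ?thesis
      using False by (subst fkm_nodes.simps) (auto simp: map_concat comp_def simp del: if_split)
  qed
qed

text \<open>Follow \<open>v\<close> downwards: its next symbol lies in the loop range because the
  prefixes of \<open>v\<close> are prenecklaces too.\<close>

lemma fkm_nodes_complete:
  assumes "lyndon_period w p" "prenecklace v" "set v \<subseteq> {..<k}" "length w \<le> length v" "length v \<le> n"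
    "take (length w) v = w"
  shows "v \<in> fst ` set (fkm_nodes k n w p)"
  using assms
proof (induction k n w p rule: fkm_nodes.induct)
  case (1 k n w p)
  let ?x = "(0 # w) ! (length w + 1 - p)"
  let ?ch = "\<lambda>i. fkm_nodes k n (w @ [i]) (if i = ?x then p else length w + 1)"
  show ?case
  proof (cases "length w = length v")
    case True
    then show ?thesis using "1.prems"(6) by (subst fkm_nodes.simps) simp
  next
    case False
    then have lt: "length w < length v" using "1.prems"(4) by simp
    define i where "i = v ! length w"
    have t: "take (length (w @ [i])) v = w @ [i]"
      using lt "1.prems"(6) by (simp add: take_Suc_conv_app_nth i_def)
    have x: "?x \<le> i"
      using prenecklace_append_ge[OF "1.prems"(1)] prenecklace_take[OF "1.prems"(2)] t by metis
    have i: "i < k" using "1.prems"(3) lt unfolding i_def by (meson lessThan_iff nth_mem subsetD)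
    have "v \<in> fst ` set (?ch i)"
      using x i lt "1.prems" t lyndon_period_child[OF "1.prems"(1) x]
      by (intro "1.IH") auto
    then obtain q where "(v, q) \<in> set (?ch i)" by force
    moreover have "i \<in> set [?x..<k]" "length w < n" using x i lt "1.prems"(5) by auto
    ultimately have "(v, q) \<in> set (fkm_nodes k n w p)"
      unfolding set_fkm_nodes[OF \<open>length w < n\<close>] by blast
    then show ?thesis by force
  qed
qed

definition fkm_leaves :: "nat \<Rightarrow> (nat list \<times> nat) list \<Rightarrow> nat list list" where
  "fkm_leaves n L = map fst (filter (\<lambda>(v, q). length v = n \<and> q dvd n) L)"

lemma fkm_leaves_append: "fkm_leaves n (L @ L') = fkm_leaves n L @ fkm_leaves n L'"
  by (simp add: fkm_leaves_def)

lemma distinct_fkm_leaves: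
  "distinct (fkm_leaves n (fkm_nodes k n [] 1))"
  using fkm_nodes_distinct[OF lyndon_period_Nil, of n k]
  by (auto simp: fkm_leaves_def distinct_map inj_on_def)

lemma set_fkm_leaves:
  assumes "1 \<le> n"
  shows "set (fkm_leaves n (fkm_nodes k n [] 1)) = necklaces k n"
proof (intro set_eqI iffI)
  fix v assume "v \<in> set (fkm_leaves n (fkm_nodes k n [] 1))"
  then obtain q where q: "(v, q) \<in> set (fkm_nodes k n [] 1)" "length v = n" "q dvd n"
    by (auto simp: fkm_leaves_def)
  then have "lyndon_period v q" "set v \<subseteq> {..<k}" "v \<noteq> []"
    using fkm_nodes_sound[OF lyndon_period_Nil _ _ q(1)] assms by auto
  then show "v \<in> necklaces k n"
    using necklace_iff_period_dvd[of v q] q by (auto simp: necklaces_def strings_def)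
next
  fix v assume v: "v \<in> necklaces k n"
  then have s: "length v = n" "set v \<subseteq> {..<k}" "necklace v" "v \<noteq> []"
    using assms by (auto simp: necklaces_def strings_def)
  have "v \<in> fst ` set (fkm_nodes k n [] 1)"
    using s necklace_prenecklace by (intro fkm_nodes_complete lyndon_period_Nil) auto
  then obtain q where q: "(v, q) \<in> set (fkm_nodes k n [] 1)" by auto
  then have "q dvd n"
    using fkm_nodes_sound[OF lyndon_period_Nil _ _ q] s necklace_iff_period_dvd[of v q] by auto
  then show "v \<in> set (fkm_leaves n (fkm_nodes k n [] 1))"
    using q s(1) by (force simp: fkm_leaves_def)
qed

section \<open>Counting the visited prenecklaces by necklaces\<close>

lemma length_fkm_leaves:
  "1 \<le> n \<Longrightarrow> length (fkm_leaves n (fkm_nodes k n [] 1)) = card (necklaces k n)"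
  by (metis distinct_card distinct_fkm_leaves set_fkm_leaves)

text \<open>If \<open>w\<close> starts below \<open>k\<close>, each appended \<open>k\<close>
  exceeds the first symbol, which the period dictates next, so the word stays Lyndon. Otherwise
  \<open>w\<close> is constant, since its first symbol is its least.\<close>

lemma necklace_pad:
  assumes "lyndon_period w (length w)" "w \<noteq> []" "set w \<subseteq> {..k}"
  shows "necklace (w @ replicate m k)"
proof (cases "w ! 0 < k")
  case True
  have "lyndon_period (w @ replicate m k) (length w + m)"
  proof (induction m)
    case (Suc m)
    have "(0 # (w @ replicate m k)) ! (length (w @ replicate m k) + 1 - (length w + m)) < k"
      using True assms(2) by (simp add: nth_append)
    from lyndon_period_append_greater[OF Suc this]
    show ?case by (simp add: replicate_append_same[symmetric])
  qed (use assms(1) in simp)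
  then show ?thesis using assms(2) by (subst necklace_iff_period_dvd) auto
next
  case False
  have "w ! i = k" if "i < length w" for i
  proof -
    have "w ! 0 \<le> w ! i"
      using prenecklaceD[OF lyndon_period_prenecklace[OF assms(1)], of i 0] that by simp
    moreover have "w ! i \<in> {..k}" using assms(3) nth_mem[OF that] by blast
    ultimately show ?thesis using False by simp
  qed
  then have "w = replicate (length w) k" by (simp add: list_eq_iff_nth_eq)
  then have "w @ replicate m k = replicate (length w + m) k" by (metis replicate_add)
  moreover have "rotate r (replicate l k) = replicate l k" for r l
    by (simp add: list_eq_iff_nth_eq nth_rotate)
  ultimately show ?thesis by (simp add: necklace_def)
qed

lemma lyndon_period_take:
  assumes "lyndon_period w p" "w \<noteq> []"
  shows "lyndon_period (take p w) p"
proof (rule lyndon_periodI)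
  have p: "1 \<le> p" "p \<le> length w" using lyndon_period_bounds[OF assms] by auto
  then show "1 \<le> p" "p \<le> max 1 (length (take p w))" by auto
  fix i assume "0 < i" "i < p"
  then obtain l where "i + l < p" "\<forall>j<l. w ! (i + j) = w ! j" "w ! l < w ! (i + l)"
    using lyndon_period_less[OF assms(1)] by blast
  then show "\<exists>l. i + l < p \<and> (\<forall>j<l. take p w ! (i + j) = take p w ! j) \<and> take p w ! l < take p w ! (i + l)"
    by (intro exI[of _ l]) auto
next
  show "take p w ! i = take p w ! (i - p)" if "p \<le> i" "i < length (take p w)" for i
    using that by simp
qed

lemma lyndon_period_determined:
  assumes "lyndon_period v p" "lyndon_period w p" "length v = length w" "take p v = take p w"
  shows "v = w"
proof (rule nth_equalityI)
  show "v ! i = w ! i" if "i < length v" for i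
    using that
  proof (induction i rule: less_induct)
    case (less i)
    show ?case
    proof (cases "i < p")
      case True
      then show ?thesis using assms(4) by (metis nth_take)
    next
      case False
      moreover have "1 \<le> p" using assms(1) by (simp add: lyndon_period_def)
      ultimately have "v ! (i - p) = w ! (i - p)" using less by auto
      then show ?thesis
        using lyndon_period_nth_diff[OF assms(1), of i] lyndon_period_nth_diff[OF assms(2), of i]
          False less.prems assms(3) by simp
    qed
  qed
qed fact

lemma finite_necklaces: "finite (necklaces k n)"
  using finite_strings[of k n] by (auto simp: necklaces_def)

lemma length_fkm_nodes_le:
  assumes "1 \<le> n" "1 \<le> k"
  shows "length (fkm_nodes k n [] 1) \<le> 2 * (n * n * card (necklaces k n))"
    and "1 \<le> card (necklaces k n)"
proof -
  let ?L = "fkm_nodes k n [] 1"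
  \<comment> \<open>The root is set aside: the empty word has no Lyndon prefix to pad.\<close>
  define A where "A = {(v, q) \<in> set ?L. v \<noteq> []}"
  define f where "f = (\<lambda>(v, q). ((length v, q), take q v @ replicate (n - q) (k - 1)))"
  have A: "lyndon_period v q" "length v \<le> n" "set v \<subseteq> {..<k}" "v \<noteq> []" "1 \<le> q" "q \<le> length v"
    if "(v, q) \<in> A" for v q
    using fkm_nodes_sound[OF lyndon_period_Nil, of n k v q] lyndon_period_bounds[of v q] that
    by (auto simp: A_def)
  have "f ` A \<subseteq> ({1..n} \<times> {1..n}) \<times> necklaces k n"
  proof
    fix y assume "y \<in> f ` A"
    then obtain v q where vq: "(v, q) \<in> A" "y = f (v, q)" by auto
    note a = A[OF vq(1)]
    have sub: "set (take q v) \<subseteq> {..<k}" using a(3) set_take_subset by fastforce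
    have "necklace (take q v @ replicate (n - q) (k - 1))"
      using lyndon_period_take[OF a(1,4)] a sub assms(2) by (intro necklace_pad) (auto simp: min_def)
    moreover have "take q v @ replicate (n - q) (k - 1) \<in> strings k n"
      using a sub assms(2) by (auto simp: strings_def)
    moreover have "1 \<le> length v" using a by linarith
    ultimately show "y \<in> ({1..n} \<times> {1..n}) \<times> necklaces k n"
      using a by (auto simp: vq(2) f_def necklaces_def)
  qed
  moreover have "inj_on f A"
  proof (rule inj_onI)
    fix x y assume xy: "x \<in> A" "y \<in> A" "f x = f y"
    obtain v q v' q' where [simp]: "x = (v, q)" "y = (v', q')" by (cases x; cases y) auto
    have "q' = q" "length v' = length v" "take q v = take q v'"
      using xy A[of v q] A[of v' q'] by (auto simp: f_def)
    moreover have "lyndon_period v q" "lyndon_period v' q'" using A(1) xy by auto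
    ultimately show "x = y" using lyndon_period_determined[of v q v'] by simp
  qed
  ultimately have "card A \<le> card (({1..n} \<times> {1..n}) \<times> necklaces k n)"
    by (intro card_inj_on_le[of f]) (auto simp: finite_necklaces)
  then have card_A: "card A \<le> n * n * card (necklaces k n)" by (simp add: card_cartesian_product)
  \<comment> \<open>As \<open>k\<close> is positive, a nonempty word is visited. This lets the
    factor 2 absorb the root and makes the number of necklaces positive.\<close>
  have "[0] \<in> fst ` set ?L"
    using assms by (intro fkm_nodes_complete lyndon_period_Nil) (auto simp: prenecklace_def)
  then have "A \<noteq> {}" by (auto simp: A_def)
  moreover have fin: "finite A" by (rule finite_subset[of _ "set ?L"]) (auto simp: A_def)
  ultimately have A1: "1 \<le> card A" by (simp add: Suc_le_eq card_gt_0_iff)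
  then show "1 \<le> card (necklaces k n)" using card_A by (cases "card (necklaces k n)") auto
  have "distinct (map fst ?L)" using fkm_nodes_distinct[OF lyndon_period_Nil, of n k] by simp
  then have "length ?L = card (fst ` set ?L)" by (metis distinct_card length_map list.set_map)
  also have "fst ` set ?L \<subseteq> insert [] (fst ` A)" by (force simp: A_def)
  then have "card (fst ` set ?L) \<le> card (insert [] (fst ` A))" using fin by (intro card_mono) auto
  also have "\<dots> \<le> Suc (card A)"
    using card_insert_le_m1 card_image_le[OF fin, of fst] card_insert_if[of "fst ` A" "[]"] fin by auto
  finally show "length ?L \<le> 2 * (n * n * card (necklaces k n))" using card_A A1 by linarith
qed

section \<open>Correctness and cost of the program\<close>

text \<open>Comparing with the least rotation decides all rotations of a dilation. Per unit, storing
  takes about \<open>9 * n\<close>, the least rotation \<open>36 * n\<close> and the comparison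
  \<open>7 * n\<close>, hence \<open>52 * n\<close>.\<close>

lemma wp_process_necklace:
  assumes n: "1 \<le> n" and xs: "xs \<in> necklaces k n"
    and alpha: "\<And>j. j < n \<Longrightarrow> mem s Alpha (Suc j) = xs ! j"
    and units: "mem s Units ` {..<u} = {d. 1 \<le> d \<and> d < n \<and> coprime d n}" and u: "u \<le> n"
  shows "wp (process_necklace n u) (\<lambda>_ s'.
     outputs s' = outputs s @ (if xs \<in> charm_bracelets k n then [xs] else []) \<and>
     mem s' Alpha = mem s Alpha \<and> mem s' Units = mem s Units \<and> clock s' \<le> clock s + 70 * (n * n)) s"
proof -
  define good where "good d \<longleftrightarrow> (\<forall>ys. is_dilation d xs ys \<longrightarrow> (\<forall>r. xs \<le> rotate r ys))" for d
  define I where "I q ok s' \<longleftrightarrow> ok = (\<forall>i<q. good (mem s Units i)) \<and> outputs s' = outputs s \<and>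
     mem s' Alpha = mem s Alpha \<and> mem s' Units = mem s Units \<and> clock s' \<le> clock s + q * (52 * n + 14)"
    for q ok and s' :: machine
  have len: "length xs = n" using xs by (auto simp: necklaces_def strings_def)
  have out: "map (mem s' Alpha) [1..<Suc n] = xs" if "mem s' Alpha = mem s Alpha" for s'
    using len alpha that by (auto simp: list_eq_iff_nth_eq simp del: upt_Suc)
  have charm: "(\<forall>i<u. good (mem s Units i)) \<longleftrightarrow> xs \<in> charm_bracelets k n"
  proof -
    have "(\<forall>i<u. good (mem s Units i)) \<longleftrightarrow> (\<forall>d \<in> mem s Units ` {..<u}. good d)" by auto
    then show ?thesis unfolding units necklace_charm_bracelets_iff[OF xs n] good_def by auto
  qed
  have test: "wp (State_Monad.bind (store_inv n d) (\<lambda>_. State_Monad.bind (least_rotation n 0 1 0) (\<lambda>r. lex_smaller n r 0)))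
      (\<lambda>b t'. b = (\<not> good d) \<and> outputs t' = outputs t \<and> mem t' Alpha = mem t Alpha \<and>
        mem t' Units = mem t Units \<and> clock t' \<le> clock t + 52 * n + 6) t"
    if d: "coprime d n" and t: "mem t Alpha = mem s Alpha" for d t
  proof -
    have "wp (State_Monad.bind (least_rotation n 0 1 0) (\<lambda>r. lex_smaller n r 0))
      (\<lambda>b t'. b = (\<not> good d) \<and> (\<exists>c \<le> 43 * n + 5. t' = t1\<lparr>clock := clock t1 + c\<rparr>)) t1"
      if t1: "\<forall>j<n. mem t1 Beta (d * j mod n) = mem t Alpha (j + 1) \<and> mem t1 Beta (d * j mod n + n) = mem t Alpha (j + 1)"
        "mem t1 Alpha = mem t Alpha" for t1
    proof -
      define ys where "ys = map (mem t1 Beta) [0..<n]"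
      have ly: "length ys = n" "ys \<noteq> []" using n by (auto simp: ys_def)
      have dil: "is_dilation d xs ys"
        using t1(1) alpha t n len by (simp add: is_dilation_def ys_def)
      \<comment> \<open>Every residue is some \<open>d * j mod n\<close>, so each cell of the upper
        half was written together with its copy in the lower half.\<close>
      have beta: "mem t1 Beta i = ys ! (i mod n)" if "i < 2 * n" for i
      proof (cases "i < n")
        case True
        then show ?thesis by (simp add: ys_def)
      next
        case False
        obtain j where j: "j < n" "d * j mod n = i mod n" using mult_mod_surj[OF d] n by (metis less_le_trans zero_less_one)
        moreover have i: "i mod n = i - n" using that False by (simp add: le_mod_geq)
        ultimately have "mem t1 Beta (i - n + n) = mem t1 Beta (i - n)" using t1(1) by metis
        then show ?thesis using False that i by (simp add: ys_def)
      qed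
      have lr: "wp (least_rotation n 0 1 0) (\<lambda>r t'. r < n \<and> (\<forall>r'. rotate r ys \<le> rotate r' ys) \<and>
          (\<exists>c \<le> 12 * (3 * n - 1) + 4. t' = t1\<lparr>clock := clock t1 + c\<rparr>)) t1"
        using wp_least_rotation[OF ly beta, where i=0 and j=1 and l=0] by simp
      have good: "good d \<longleftrightarrow> xs \<le> rotate r ys" if "\<forall>r'. rotate r ys \<le> rotate r' ys" for r
        using that dil is_dilation_unique[OF _ dil] d len unfolding good_def by (metis order_trans)
      have lex: "wp (lex_smaller n r 0) (\<lambda>b t'. b = (\<not> good d) \<and> (\<exists>c \<le> 43 * n + 5. t' = t1\<lparr>clock := clock t1 + c\<rparr>)) t2"
        if r: "r < n" "\<forall>r'. rotate r ys \<le> rotate r' ys" and c: "c \<le> 12 * (3 * n - 1) + 4"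
          and t2: "t2 = t1\<lparr>clock := clock t1 + c\<rparr>" for r c t2
      proof -
        have rot: "mem t2 Beta (r + h) = rotate r ys ! h" if "h < n" for h
          using that r(1) beta[of "r + h"] ly t2 by (simp add: nth_rotate)
        have al: "mem t2 Alpha (Suc h) = xs ! h" if "h < n" for h
          using that t1(2) t alpha t2 by simp
        have "wp (lex_smaller n r 0) (\<lambda>b t'. b = (rotate r ys < xs) \<and> (\<exists>c \<le> 7 * (n - 0) + 1. t' = t2\<lparr>clock := clock t2 + c\<rparr>)) t2"
          using rot al ly len by (intro wp_lex_smaller) auto
        then show ?thesis
        proof (rule wp_mono)
          fix b t' assume *: "b = (rotate r ys < xs) \<and> (\<exists>c \<le> 7 * (n - 0) + 1. t' = t2\<lparr>clock := clock t2 + c\<rparr>)"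
          then obtain c' where "c' \<le> 7 * n + 1" "t' = t2\<lparr>clock := clock t2 + c'\<rparr>" by auto
          then have "c + c' \<le> 43 * n + 5" "t' = t1\<lparr>clock := clock t1 + (c + c')\<rparr>"
            using c n t2 by auto
          then show "b = (\<not> good d) \<and> (\<exists>c \<le> 43 * n + 5. t' = t1\<lparr>clock := clock t1 + c\<rparr>)"
            using * good[OF r(2)] by auto
        qed
      qed
      show ?thesis
        unfolding wp_bind by (rule wp_mono[OF lr]) (use lex in blast)
    qed
    note rest = this
    show ?thesis
      unfolding wp_bind[of "store_inv n d"]
      apply (rule wp_mono[OF wp_store_inv[OF d n]])
      apply (rule wp_mono[OF rest])
      by auto
  qed
  have body: "wp (do { d \<leftarrow> rd Units q; store_inv n d; r \<leftarrow> least_rotation n 0 1 0; b \<leftarrow> lex_smaller n r 0;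
       branch b (ret False) (ret ok) }) (\<lambda>z s'. I (Suc q) z (s'\<lparr>clock := clock s' + 1\<rparr>)) (t\<lparr>clock := clock t + 1\<rparr>)"
    if q: "q < u" and I: "I q ok t" for q ok t
  proof -
    define d where "d = mem s Units q"
    have "d \<in> mem s Units ` {..<u}" using q by (auto simp: d_def)
    then have d: "coprime d n" unfolding units by simp
    define t1 where "t1 = t\<lparr>clock := clock t + 2\<rparr>"
    have t1: "mem t1 Alpha = mem s Alpha" using I by (simp add: I_def t1_def)
    have "wp (State_Monad.bind (store_inv n d) (\<lambda>_. State_Monad.bind (least_rotation n 0 1 0) (\<lambda>r. lex_smaller n r 0)))
      (\<lambda>b. wp (branch b (ret False) (ret ok)) (\<lambda>z s'. I (Suc q) z (s'\<lparr>clock := clock s' + 1\<rparr>))) t1"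
      apply (rule wp_mono[OF test[OF d t1]])
      using I by (auto simp: I_def d_def t1_def less_Suc_eq)
    then show ?thesis
      using I by (simp add: I_def d_def t1_def)
  qed
  have "wp (for_loop 0 u (\<lambda>q ok. do { d \<leftarrow> rd Units q; store_inv n d; r \<leftarrow> least_rotation n 0 1 0;
      b \<leftarrow> lex_smaller n r 0; branch b (ret False) (ret ok) }) True)
     (\<lambda>ok s'. ok = (xs \<in> charm_bracelets k n) \<and> outputs s' = outputs s \<and>
     mem s' Alpha = mem s Alpha \<and> mem s' Units = mem s Units \<and> clock s' \<le> clock s + u * (52 * n + 14) + 1) s"
    by (rule wp_for_loop[where I = I]) (use body charm in \<open>auto simp: I_def\<close>)
  \<comment> \<open>The extra \<open>2 + n\<close> is the last loop test, the branch on
    \<open>ok\<close> and the output.\<close>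
  moreover have "u * (52 * n + 14) + (2 + n) \<le> 70 * (n * n)"
  proof -
    have "u * (52 * n + 14) \<le> n * (52 * n + 14)" using u by (rule mult_right_mono) simp
    also have "n * (52 * n + 14) + (2 + n) \<le> 70 * (n * n)" using n by (cases n) (auto simp: algebra_simps)
    finally show ?thesis by simp
  qed
  ultimately show ?thesis
    unfolding process_necklace_def wp_bind[of "for_loop 0 u _ _"]
    apply (elim wp_mono)
    using out[of s] by (auto simp del: upt_Suc)
qed

text \<open>The 9 units per node are at most four of its own and five for the loop iteration leading
  to it. The measure is additive, so the costs of subtrees add up.\<close>

definition fkm_cost :: "nat \<Rightarrow> (nat list \<times> nat) list \<Rightarrow> nat" where
  "fkm_cost n L = 9 * length L + 70 * (n * n) * length (fkm_leaves n L)"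

lemma fkm_cost_append: "fkm_cost n (L @ L') = fkm_cost n L + fkm_cost n L'"
  by (simp add: fkm_cost_def fkm_leaves_append algebra_simps)

text \<open>
  The surplus 5 pays for the loop iteration of the caller that leads to this call.
\<close>

lemma wp_gen_charm:
  assumes n: "1 \<le> n" and w: "lyndon_period w p" "length w \<le> n" "set w \<subseteq> {..<k}"
    and alpha: "\<And>j. j \<le> length w \<Longrightarrow> mem s Alpha j = (0 # w) ! j"
    and units: "mem s Units ` {..<u} = {d. 1 \<le> d \<and> d < n \<and> coprime d n}" and u: "u \<le> n"
  shows "wp (gen_charm n k u (Suc (length w)) p) (\<lambda>_ s'.
     outputs s' = outputs s @ filter (\<lambda>v. v \<in> charm_bracelets k n) (fkm_leaves n (fkm_nodes k n w p)) \<and>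
     (\<forall>j \<le> length w. mem s' Alpha j = mem s Alpha j) \<and> mem s' Units = mem s Units \<and>
     clock s' + 5 \<le> clock s + fkm_cost n (fkm_nodes k n w p)) s"
  using assms
proof (induction k n w p arbitrary: s rule: fkm_nodes.induct)
  case (1 k n w p)
  note n = "1.prems"(1) and w = "1.prems"(2,3,4) and alpha = "1.prems"(5) and units = "1.prems"(6) and u = "1.prems"(7)
  show ?case
  proof (cases "n \<le> length w")
    case True
    then have len: "length w = n" "w \<noteq> []" using w(2) n by auto
    have nodes: "fkm_nodes k n w p = [(w, p)]" using True by (subst fkm_nodes.simps) simp
    have al: "mem (s\<lparr>clock := c\<rparr>) Alpha (Suc j) = w ! j" if "j < n" for j c
      using alpha[of "Suc j"] that len by simp
    have pn: "wp (process_necklace n u) (\<lambda>_ s'. outputs s' = outputs s @ (if w \<in> charm_bracelets k n then [w] else []) \<and>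
       mem s' Alpha = mem s Alpha \<and> mem s' Units = mem s Units \<and> clock s' \<le> clock s + 3 + 70 * (n * n))
       (s\<lparr>clock := clock s + 3\<rparr>)" if "p dvd n"
    proof -
      have "w \<in> necklaces k n"
        using that len w necklace_iff_period_dvd[OF w(1) len(2)] by (auto simp: necklaces_def strings_def)
      from wp_process_necklace[OF n this al _ u, of "clock s + 3"] units
      show ?thesis by simp
    qed
    show ?thesis
    proof (cases "p dvd n")
      case True
      then have leaves: "fkm_leaves n [(w, p)] = [w]" using len by (simp add: fkm_leaves_def)
      show ?thesis
        unfolding nodes leaves fkm_cost_def
        apply (subst gen_charm.simps)
        using True pn[OF True] len apply (simp add: dvd_eq_mod_eq_0 numeral_3_eq_3)
        by (auto elim!: wp_mono)
    next
      case False
      then have leaves: "fkm_leaves n [(w, p)] = []" by (simp add: fkm_leaves_def)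
      show ?thesis
        unfolding nodes leaves fkm_cost_def
        using False len by (subst gen_charm.simps) (simp add: dvd_eq_mod_eq_0)
    qed
  next
    case False
    define x where "x = (0 # w) ! (length w + 1 - p)"
    define ch where "ch i = fkm_nodes k n (w @ [i]) (if i = x then p else length w + 1)" for i
    define out where "out L = filter (\<lambda>v. v \<in> charm_bracelets k n) (fkm_leaves n L)" for L
    have nodes: "fkm_nodes k n w p = (w, p) # concat (map ch [x..<k])"
      using False unfolding ch_def x_def by (subst fkm_nodes.simps) (simp del: if_split)
    have p: "1 \<le> p" using w(1) by (simp add: lyndon_period_def)
    have x: "mem s Alpha (Suc (length w) - p) = x" using alpha[of "Suc (length w) - p"] p by (simp add: x_def)
    define I where "I i y s' \<longleftrightarrow> outputs s' = outputs s @ out (concat (map ch [x..<i])) \<and>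
       (\<forall>j \<le> length w. mem s' Alpha j = mem s Alpha j) \<and> mem s' Units = mem s Units \<and>
       clock s' \<le> clock s + 3 + fkm_cost n (concat (map ch [x..<i]))" for i and y :: unit and s' :: machine
    \<comment> \<open>The four units are the loop test, the write, the increment of \<open>t\<close>
      and the branch; the fifth is the increment of the loop index afterwards.\<close>
    have child: "wp (gen_charm n k u (Suc (Suc (length w))) (if i = x then p else length w + 1))
        (\<lambda>_ s'. I (Suc i) () (s'\<lparr>clock := clock s' + 1\<rparr>))
        (t\<lparr>mem := (mem t)(Alpha := (mem t Alpha)(Suc (length w) := i)), clock := clock t + 4\<rparr>)"
      (is "wp _ _ ?t") if i: "x \<le> i" "i < k" and I: "I i () t" for i t
    proof -
      have "wp (gen_charm n k u (Suc (length (w @ [i]))) (if i = x then p else length w + 1)) (\<lambda>_ s'.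
         outputs s' = outputs ?t @ out (ch i) \<and>
         (\<forall>j \<le> length (w @ [i]). mem s' Alpha j = mem ?t Alpha j) \<and> mem s' Units = mem ?t Units \<and>
         clock s' + 5 \<le> clock ?t + fkm_cost n (ch i)) ?t"
        unfolding out_def ch_def x_def
      proof (rule "1.IH")
        show "lyndon_period (w @ [i]) (if i = (0 # w) ! (length w + 1 - p) then p else length w + 1)"
          using lyndon_period_child[OF w(1)] i(1) by (simp add: x_def)
        show "mem ?t Alpha j = (0 # w @ [i]) ! j" if "j \<le> length (w @ [i])" for j
        proof (cases "j = Suc (length w)")
          case False
          then have "j < length (0 # w)" using that by simp
          then have "mem t Alpha j = (0 # w) ! j" using I alpha[of j] by (simp add: I_def)
          also have "\<dots> = ((0 # w) @ [i]) ! j" using \<open>j < length (0 # w)\<close> by (simp only: nth_append if_True)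
          finally show ?thesis using False by simp
        qed simp
        show "mem ?t Units ` {..<u} = {d. 1 \<le> d \<and> d < n \<and> coprime d n}"
          using I units by (simp add: I_def)
      qed (use False i n u w(3) in \<open>auto simp: x_def\<close>)
      then show ?thesis
        unfolding length_append_singleton
        apply (elim wp_mono)
        using I i(1) by (auto simp: I_def upt_Suc_append fkm_cost_append out_def fkm_leaves_append)
    qed
    \<comment> \<open>\<open>max x k\<close> also covers an empty loop with \<open>k < x\<close>.
      The last loop test is taken off the clock; \<open>1 \<le> clock s'\<close> keeps this
      subtraction exact.\<close>
    have "wp (for_loop x k (\<lambda>i _. do {
               wr Alpha (Suc (length w)) i;
               t' \<leftarrow> calc (Suc (length w) + 1);
               branch (i = x) (gen_charm n k u t' p) (gen_charm n k u t' (Suc (length w))) }) ())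
       (\<lambda>_ s'. I (max x k) () (s'\<lparr>clock := clock s' - 1\<rparr>)\<and> 1 \<le> clock s') (s\<lparr>clock := clock s + 3\<rparr>)"
    proof (cases "x \<le> k")
      case True
      show ?thesis
        apply (rule wp_for_loop[where I = I])
        subgoal by (rule True)
        subgoal by (simp add: I_def out_def fkm_leaves_def fkm_cost_def)
        subgoal for i y t
          using child[of i t] by (auto simp: numeral_eq_Suc)
        subgoal using True by (simp add: max_def)
        done
    next
      case False
      then show ?thesis by (subst for_loop.simps) (simp add: I_def out_def fkm_leaves_def fkm_cost_def)
    qed
    then show ?thesis
      apply (subst gen_charm.simps)
      using False apply (simp add: x numeral_3_eq_3)
      apply (elim wp_mono)
      unfolding nodes
      by (auto simp: I_def out_def fkm_leaves_def fkm_cost_def max_def split: if_splits)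
  qed
qed

text \<open>Lets the set-up time be charged to the bracelets.\<close>

lemma card_charm_bracelets_pos:
  assumes "1 \<le> n" "1 \<le> k"
  shows "1 \<le> card (charm_bracelets k n)"
  using length_fkm_nodes_le(2)[OF assms] card_necklaces_le[OF assms(1), of k]
  by (cases "card (charm_bracelets k n)") auto

lemma wp_charm_program:
  assumes "1 \<le> n"
  shows "wp (charm_program n k) (\<lambda>_ s'.
     outputs s' = filter (\<lambda>v. v \<in> charm_bracelets k n) (fkm_leaves n (fkm_nodes k n [] 1)) \<and>
     clock s' \<le> n * (2 * n + 6) + 1 + fkm_cost n (fkm_nodes k n [] 1)) initial_machine"
proof -
  have "wp (gen_charm n k u 1 1) (\<lambda>_ s'.
     outputs s' = filter (\<lambda>v. v \<in> charm_bracelets k n) (fkm_leaves n (fkm_nodes k n [] 1)) \<and>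
     clock s' \<le> n * (2 * n + 6) + 1 + fkm_cost n (fkm_nodes k n [] 1)) s"
    if "u \<le> n" "mem s Units ` {..<u} = {d. 1 \<le> d \<and> d < n \<and> coprime d n}" "mem s Alpha 0 = 0"
      "outputs s = []" "clock s \<le> n * (2 * n + 6) + 1" for u s
    using wp_gen_charm[OF assms lyndon_period_Nil, of k s u] that
    by (auto elim!: wp_mono)
  then show ?thesis
    unfolding charm_program_def wp_bind[of "find_units n"]
    by (intro wp_mono[OF wp_find_units[OF assms]]) (auto simp: initial_machine_def)
qed

theorem mainTheorem1:
  shows "(\<forall>n k. 1 \<le> n \<and> 2 \<le> k \<longrightarrow>
            set (charm_output n k) = charm_bracelets k n \<and> distinct (charm_output n k)) \<and>
         (\<exists>C::nat. \<forall>n k. 1 \<le> n \<and> 2 \<le> k \<longrightarrow>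
            charm_time n k \<le> C * (n ^ 3 * card (charm_bracelets k n)))"
proof (intro conjI exI[of _ 100] allI impI; elim conjE)
  fix n k :: nat assume n: "1 \<le> n" and k: "2 \<le> k"
  have prog: "charm_output n k = filter (\<lambda>v. v \<in> charm_bracelets k n) (fkm_leaves n (fkm_nodes k n [] 1))"
    "charm_time n k \<le> n * (2 * n + 6) + 1 + fkm_cost n (fkm_nodes k n [] 1)"
    using wp_charm_program[OF n, of k] by (auto simp: charm_output_def charm_time_def wp_def split_beta)
  show "set (charm_output n k) = charm_bracelets k n"
    using set_fkm_leaves[OF n, of k] charm_bracelets_subset_necklaces[OF n, of k] by (auto simp: prog(1))
  show "distinct (charm_output n k)" using distinct_fkm_leaves[of n k] by (simp add: prog(1))
  let ?N = "card (necklaces k n)" and ?C = "card (charm_bracelets k n)"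
  \<comment> \<open>The constant splits into 18 for the nodes, 70 for the tests and 9 for the
    set-up, which stays below 100.\<close>
  have "fkm_cost n (fkm_nodes k n [] 1) \<le> 9 * (2 * (n * n * ?N)) + 70 * (n * n) * ?N"
    using length_fkm_nodes_le(1)[OF n, of k] k unfolding fkm_cost_def length_fkm_leaves[OF n] by simp
  also have "\<dots> = 88 * (n * n) * ?N" by simp
  also have "\<dots> \<le> 88 * (n * n) * (n * ?C)" by (intro mult_left_mono card_necklaces_le n) simp
  also have "\<dots> = 88 * (n ^ 3 * ?C)" by (simp add: power3_eq_cube)
  finally have cost: "fkm_cost n (fkm_nodes k n [] 1) \<le> 88 * (n ^ 3 * ?C)" .
  have "n * (2 * n + 6) + 1 \<le> 9 * (n * n)" using n by (cases n) (auto simp: algebra_simps)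
  also have "\<dots> \<le> 9 * (n * n * (n * ?C))"
    using n card_charm_bracelets_pos[OF n, of k] k by simp
  also have "\<dots> = 9 * (n ^ 3 * ?C)" by (simp add: power3_eq_cube)
  finally show "charm_time n k \<le> 100 * (n ^ 3 * ?C)" using prog(2) cost by linarith
qed

end
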